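(* Let $(M,k)$ be a Riemannian manifold and let $G$ be a Lie group acting freely and properly on $M$, so that $\pi_{M/G}:M\to M/G$ is a principal bundle, with $k$ invariant under $G$. Let $A$ be the mechanical connection of $k$ and let $\nabla$ be the Levi-Civita connection of $k$. Let $\bar X^h$ and $\bar Y^h$ be $G$-invariant horizontal vector fields on $M$, let $x\in M$, $\xi\in\mathfrak g$, and let $\xi^V_L$ be a $G$-invariant vertical vector field on $M$ with $\xi^V_L(x)=\xi_M(x)$. Then $$k\big(\langle\bar X^h:\xi^V_L\rangle(x),\bar Y^h(x)\big)=k\big(\big(B_A(\bar X^h(x),\bar Y^h(x))\big)_M(x),\ \xi^V_L(x)\big),$$ where $B_A$ is the curvature form of $A$.
   Context: $\mathfrak g$ is the Lie algebra of $G$; $\xi_M$ is the infinitesimal generator on $M$ of $\xi\in\mathfrak g$. The mechanical connection is the principal connection on $M\to M/G$ whose horizontal subbundle is the $k$-orthogonal complement of the vertical subbundle $VM=\ker T\pi_{M/G}$; its connection one-form is $A:TM\to\mathfrak g$ with $A(\xi_M(x))=\xi$. The symmetric product is $\langle X:Y\rangle=\nabla_XY+\nabla_YX$. $\bar X^h$ denotes the horizontal lift of a vector field $\bar X$ on $M/G$. The curvature form is the $\mathfrak g$-valued two-form $B_A$ with the convention $[\bar X^h,\bar Y^h](x)=[\bar X,\bar Y]^h(x)-\big(B_A(\bar X^h(x),\bar Y^h(x))\big)_M(x)$. *)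

theory Defs
  imports
    "HOL-Analysis.Analysis"
    "HOL-Algebra.Group_Action"
    "HOL-Library.Function_Algebras"
begin

section \<open>Smooth manifolds\<close>

text \<open>Model spaces are finite-dimensional real inner product spaces. In contrast to
  \<^class>\<open>euclidean_space\<close> the dimension may be 0, so that discrete groups and transitive actions
  (where the orbit space is a point) are not excluded.\<close>

class fin_dim_inner = real_inner +
  assumes ex_finite_total: "\<exists>B. finite B \<and> (\<forall>x. (\<forall>b\<in>B. inner x b = 0) \<longrightarrow> x = 0)"

lemma ex_finite_spanning: "\<exists>B::'a::fin_dim_inner set. finite B \<and> span B = UNIV"
proof -
  obtain B :: "'a set" where B: "finite B" "\<And>x. (\<forall>b\<in>B. inner x b = 0) \<Longrightarrow> x = 0"
    using ex_finite_total by metis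
  obtain C where C: "finite C" "span C = span B" "pairwise orthogonal C"
    using basis_orthogonal[OF B(1)] by blast
  have "x \<in> span C" for x
  proof -
    define p where "p = (\<Sum>c\<in>C. (c \<bullet> x / (c \<bullet> c)) *\<^sub>R c)"
    have "orthogonal (x - p) c" if c: "c \<in> C" for c
    proof -
      have "p \<bullet> c = (\<Sum>d\<in>C. if d = c then (c \<bullet> x / (c \<bullet> c)) * (c \<bullet> c) else 0)"
        unfolding p_def inner_sum_left
        using C(3) c by (intro sum.cong) (auto simp: pairwise_def orthogonal_def)
      also have "\<dots> = x \<bullet> c"
        using C(1) c by (simp add: inner_commute)
      finally show ?thesis
        by (simp add: orthogonal_def inner_diff_left)
    qed
    then have "orthogonal (x - p) b" if "b \<in> B" for b
      using orthogonal_to_span[of b C "x - p"] span_base[OF that] C(2) by simp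
    then have "x - p = 0"
      by (intro B(2)) (simp add: orthogonal_def)
    moreover have "p \<in> span C"
      unfolding p_def by (intro span_sum span_scale span_base)
    ultimately show ?thesis
      by simp
  qed
  then show ?thesis
    using C(1) by blast
qed

instance euclidean_space \<subseteq> fin_dim_inner
  by standard (use euclidean_all_zero_iff finite_Basis in blast)

instance prod :: (fin_dim_inner, fin_dim_inner) fin_dim_inner
proof
  obtain B :: "'a set" where B: "finite B" "\<And>x. (\<forall>b\<in>B. inner x b = 0) \<Longrightarrow> x = 0"
    using ex_finite_total by metis
  obtain C :: "'b set" where C: "finite C" "\<And>x. (\<forall>b\<in>C. inner x b = 0) \<Longrightarrow> x = 0"
    using ex_finite_total by metis
  have "finite (B \<times> {0} \<union> {0} \<times> C)"
    using B(1) C(1) by simp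
  moreover have "z = 0" if "\<forall>d\<in>B \<times> {0} \<union> {0} \<times> C. inner z d = 0" for z
  proof -
    have "\<forall>b\<in>B. inner (fst z) b = 0" "\<forall>c\<in>C. inner (snd z) c = 0"
      using that by (force simp: inner_prod_def)+
    then show ?thesis
      using B(2) C(2) by (simp add: prod_eq_iff)
  qed
  ultimately show "\<exists>D::('a \<times> 'b) set. finite D \<and> (\<forall>z. (\<forall>d\<in>D. inner z d = 0) \<longrightarrow> z = 0)"
    by blast
qed

instantiation unit :: fin_dim_inner
begin

definition "(0::unit) = ()"
definition "(_::unit) + _ = ()"
definition "_ *\<^sub>R (_::unit) = ()"
definition "norm (_::unit) = 0"
definition "sgn (_::unit) = ()"
definition "dist (_::unit) _ = 0"
definition "inner (_::unit) _ = 0"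
definition "(uniformity :: (unit \<times> unit) filter) = (INF e\<in>{0<..}. principal {(x, y). dist x y < e})"
definition "open (_::unit set) = True"

instance
proof
  show "open U \<longleftrightarrow> (\<forall>x\<in>U. \<forall>\<^sub>F (x', y) in uniformity. x' = x \<longrightarrow> y \<in> U)" for U :: "unit set"
    by (auto simp: open_unit_def intro!: always_eventually)
qed (auto simp: uniformity_unit_def norm_unit_def dist_unit_def inner_unit_def)

end

text \<open>For maps between finite-dimensional spaces, being \<open>C\<^sup>k\<close> on an open set can be expressed through
  the directional derivatives, which keeps the type of the function fixed along the recursion.\<close>

primrec Ck_on :: "nat \<Rightarrow> 'a::real_normed_vector set \<Rightarrow> ('a \<Rightarrow> 'b::real_normed_vector) \<Rightarrow> bool" where
  "Ck_on 0 S f \<longleftrightarrow> continuous_on S f"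
| "Ck_on (Suc k) S f \<longleftrightarrow>
     (\<forall>x\<in>S. f differentiable (at x)) \<and> (\<forall>v. Ck_on k S (\<lambda>x. frechet_derivative f (at x) v))"

definition smooth_on :: "'a::real_normed_vector set \<Rightarrow> ('a \<Rightarrow> 'b::real_normed_vector) \<Rightarrow> bool" where
  "smooth_on S f \<longleftrightarrow> (\<forall>k. Ck_on k S f)"

type_synonym ('m, 'e) chart = "'m set \<times> ('m \<Rightarrow> 'e)"

record ('m, 'e) manifold =
  mtop :: "'m topology"
  atlas :: "('m, 'e) chart set"

abbreviation points :: "('m, 'e) manifold \<Rightarrow> 'm set" where
  "points M \<equiv> topspace (mtop M)"

definition chart_inv :: "('m, 'e) chart \<Rightarrow> 'e \<Rightarrow> 'm" where
  "chart_inv c = inv_into (fst c) (snd c)"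

definition transition :: "('m, 'e) chart \<Rightarrow> ('m, 'e) chart \<Rightarrow> 'e \<Rightarrow> 'e" where
  "transition c d = snd d \<circ> chart_inv c"

definition second_countable :: "'a topology \<Rightarrow> bool" where
  "second_countable X \<longleftrightarrow>
     (\<exists>\<B>. countable \<B> \<and> (\<forall>V\<in>\<B>. openin X V) \<and>
          (\<forall>U x. openin X U \<and> x \<in> U \<longrightarrow> (\<exists>V\<in>\<B>. x \<in> V \<and> V \<subseteq> U)))"

definition smooth_manifold :: "('m, 'e::fin_dim_inner) manifold \<Rightarrow> bool" where
  "smooth_manifold M \<longleftrightarrow>
     Hausdorff_space (mtop M) \<and> second_countable (mtop M) \<and>
     (\<Union>c\<in>atlas M. fst c) = points M \<and>
     (\<forall>c\<in>atlas M. openin (mtop M) (fst c) \<and> open (snd c ` fst c) \<and>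
        homeomorphic_map (subtopology (mtop M) (fst c)) (top_of_set (snd c ` fst c)) (snd c)) \<and>
     (\<forall>c\<in>atlas M. \<forall>d\<in>atlas M. smooth_on (snd c ` (fst c \<inter> fst d)) (transition c d))"

definition prod_manifold ::
    "('m, 'e) manifold \<Rightarrow> ('n, 'f) manifold \<Rightarrow> ('m \<times> 'n, 'e \<times> 'f) manifold" where
  "prod_manifold M N =
     \<lparr>mtop = prod_topology (mtop M) (mtop N),
      atlas = {(fst c \<times> fst d, map_prod (snd c) (snd d)) |c d. c \<in> atlas M \<and> d \<in> atlas N}\<rparr>"

definition open_submanifold :: "('m, 'e) manifold \<Rightarrow> 'm set \<Rightarrow> ('m, 'e) manifold" where
  "open_submanifold M W =
     \<lparr>mtop = subtopology (mtop M) W, atlas = {(fst c \<inter> W, snd c) |c. c \<in> atlas M}\<rparr>"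

definition smooth_map ::
    "('m, 'e::real_normed_vector) manifold \<Rightarrow> ('n, 'f::real_normed_vector) manifold \<Rightarrow> ('m \<Rightarrow> 'n) \<Rightarrow> bool"
  where
  "smooth_map M N f \<longleftrightarrow> continuous_map (mtop M) (mtop N) f \<and>
     (\<forall>c\<in>atlas M. \<forall>d\<in>atlas N.
        smooth_on (snd c ` {p \<in> fst c. f p \<in> fst d}) (snd d \<circ> f \<circ> chart_inv c))"

definition diffeomorphism ::
    "('m, 'e::real_normed_vector) manifold \<Rightarrow> ('n, 'f::real_normed_vector) manifold \<Rightarrow> ('m \<Rightarrow> 'n) \<Rightarrow> bool"
  where
  "diffeomorphism M N f \<longleftrightarrow> smooth_map M N f \<and>
     (\<exists>g. smooth_map N M g \<and> (\<forall>p\<in>points M. g (f p) = p) \<and> (\<forall>q\<in>points N. f (g q) = q))"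

definition smooth_fun :: "('m, 'e::real_normed_vector) manifold \<Rightarrow> ('m \<Rightarrow> real) \<Rightarrow> bool" where
  "smooth_fun M f \<longleftrightarrow> (\<forall>c\<in>atlas M. smooth_on (snd c ` fst c) (f \<circ> chart_inv c))"


section \<open>Tangent vectors and vector fields\<close>

text \<open>A tangent vector at \<open>p\<close> is the family of its coordinate vectors in all charts around \<open>p\<close>,
  related by the derivatives of the transition maps. It is 0 at the other charts, which makes the
  tangent space a space of functions with pointwise operations.\<close>

type_synonym ('m, 'e) tvec = "('m, 'e) chart \<Rightarrow> 'e"

definition charts_at :: "('m, 'e) manifold \<Rightarrow> 'm \<Rightarrow> ('m, 'e) chart set" where
  "charts_at M p = {c \<in> atlas M. p \<in> fst c}"

definition tangent_space :: "('m, 'e::real_normed_vector) manifold \<Rightarrow> 'm \<Rightarrow> ('m, 'e) tvec set" where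
  "tangent_space M p =
     {v. (\<forall>c\<in>charts_at M p. \<forall>d\<in>charts_at M p.
            v d = frechet_derivative (transition c d) (at (snd c p)) (v c)) \<and>
         (\<forall>c. c \<notin> charts_at M p \<longrightarrow> v c = 0)}"

definition tscale :: "real \<Rightarrow> ('m, 'e::real_vector) tvec \<Rightarrow> ('m, 'e) tvec" where
  "tscale a v = (\<lambda>c. a *\<^sub>R v c)"

text \<open>The tangent vector at \<open>p\<close> with coordinates \<open>u\<close> in the chart \<open>c\<close> around \<open>p\<close>.\<close>

definition coord_tvec ::
    "('m, 'e::real_normed_vector) manifold \<Rightarrow> ('m, 'e) chart \<Rightarrow> 'm \<Rightarrow> 'e \<Rightarrow> ('m, 'e) tvec" where
  "coord_tvec M c p u = (\<lambda>d. if d \<in> charts_at M p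
     then frechet_derivative (transition c d) (at (snd c p)) u else 0)"

text \<open>In the next two definitions the result does not depend on the chosen chart \<open>c\<close> around \<open>p\<close> if
  \<open>v\<close> is a tangent vector at \<open>p\<close>.\<close>

definition tangent_map ::
    "('m, 'e::real_normed_vector) manifold \<Rightarrow> ('n, 'f::real_normed_vector) manifold \<Rightarrow>
     ('m \<Rightarrow> 'n) \<Rightarrow> 'm \<Rightarrow> ('m, 'e) tvec \<Rightarrow> ('n, 'f) tvec" where
  "tangent_map M N f p v = (\<lambda>d. if d \<in> charts_at N (f p)
     then let c = SOME c. c \<in> charts_at M p
          in frechet_derivative (snd d \<circ> f \<circ> chart_inv c) (at (snd c p)) (v c)
     else 0)"

definition dir_deriv ::
    "('m, 'e::real_normed_vector) manifold \<Rightarrow> ('m, 'e) tvec \<Rightarrow> ('m \<Rightarrow> real) \<Rightarrow> 'm \<Rightarrow> real" where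
  "dir_deriv M v f p = (let c = SOME c. c \<in> charts_at M p
     in frechet_derivative (f \<circ> chart_inv c) (at (snd c p)) (v c))"

definition coord_field :: "('m \<Rightarrow> ('m, 'e) tvec) \<Rightarrow> ('m, 'e) chart \<Rightarrow> 'e \<Rightarrow> 'e" where
  "coord_field X c = (\<lambda>y. X (chart_inv c y) c)"

definition vector_field ::
    "('m, 'e::real_normed_vector) manifold \<Rightarrow> ('m \<Rightarrow> ('m, 'e) tvec) \<Rightarrow> bool" where
  "vector_field M X \<longleftrightarrow> (\<forall>p\<in>points M. X p \<in> tangent_space M p) \<and>
     (\<forall>c\<in>atlas M. smooth_on (snd c ` fst c) (coord_field X c))"

text \<open>The Lie bracket in coordinates: \<open>[X, Y]\<^sup>i = X\<^sup>j \<partial>\<^sub>j Y\<^sup>i - Y\<^sup>j \<partial>\<^sub>j X\<^sup>i\<close>.\<close>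

definition lie_bracket ::
    "('m, 'e::real_normed_vector) manifold \<Rightarrow> ('m \<Rightarrow> ('m, 'e) tvec) \<Rightarrow> ('m \<Rightarrow> ('m, 'e) tvec) \<Rightarrow>
     'm \<Rightarrow> ('m, 'e) tvec" where
  "lie_bracket M X Y p = (\<lambda>c. if c \<in> charts_at M p
     then frechet_derivative (coord_field Y c) (at (snd c p)) (X p c)
          - frechet_derivative (coord_field X c) (at (snd c p)) (Y p c)
     else 0)"


section \<open>Riemannian metrics and the Levi-Civita connection\<close>

definition riemannian_metric ::
    "('m, 'e::real_normed_vector) manifold \<Rightarrow> ('m \<Rightarrow> ('m, 'e) tvec \<Rightarrow> ('m, 'e) tvec \<Rightarrow> real) \<Rightarrow> bool"
  where
  "riemannian_metric M k \<longleftrightarrow>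
     (\<forall>p\<in>points M. \<forall>u\<in>tangent_space M p. \<forall>v\<in>tangent_space M p.
        k p u v = k p v u \<and>
        (\<forall>w\<in>tangent_space M p. k p (u + v) w = k p u w + k p v w) \<and>
        (\<forall>a. k p (tscale a u) v = a * k p u v) \<and>
        (u \<noteq> 0 \<longrightarrow> k p u u > 0)) \<and>
     (\<forall>c\<in>atlas M. \<forall>u v. smooth_on (snd c ` fst c)
        (\<lambda>y. let p = chart_inv c y in k p (coord_tvec M c p u) (coord_tvec M c p v)))"

definition affine_connection ::
    "('m, 'e::real_normed_vector) manifold \<Rightarrow>
     (('m \<Rightarrow> ('m, 'e) tvec) \<Rightarrow> ('m \<Rightarrow> ('m, 'e) tvec) \<Rightarrow> 'm \<Rightarrow> ('m, 'e) tvec) \<Rightarrow> bool" where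
  "affine_connection M nabla \<longleftrightarrow>
     (\<forall>X Y. vector_field M X \<and> vector_field M Y \<longrightarrow> vector_field M (nabla X Y)) \<and>
     (\<forall>X Y Z. vector_field M X \<and> vector_field M Y \<and> vector_field M Z \<longrightarrow>
        (\<forall>p\<in>points M. nabla (X + Y) Z p = nabla X Z p + nabla Y Z p \<and>
                     nabla X (Y + Z) p = nabla X Y p + nabla X Z p)) \<and>
     (\<forall>f X Y. smooth_fun M f \<and> vector_field M X \<and> vector_field M Y \<longrightarrow>
        (\<forall>p\<in>points M. nabla (\<lambda>q. tscale (f q) (X q)) Y p = tscale (f p) (nabla X Y p) \<and>
                     nabla X (\<lambda>q. tscale (f q) (Y q)) p
                       = tscale (dir_deriv M (X p) f p) (Y p) + tscale (f p) (nabla X Y p)))"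

definition levi_civita ::
    "('m, 'e::real_normed_vector) manifold \<Rightarrow> ('m \<Rightarrow> ('m, 'e) tvec \<Rightarrow> ('m, 'e) tvec \<Rightarrow> real) \<Rightarrow>
     (('m \<Rightarrow> ('m, 'e) tvec) \<Rightarrow> ('m \<Rightarrow> ('m, 'e) tvec) \<Rightarrow> 'm \<Rightarrow> ('m, 'e) tvec) \<Rightarrow> bool" where
  "levi_civita M k nabla \<longleftrightarrow> affine_connection M nabla \<and>
     (\<forall>X Y. vector_field M X \<and> vector_field M Y \<longrightarrow>
        (\<forall>p\<in>points M. nabla X Y p - nabla Y X p = lie_bracket M X Y p)) \<and>
     (\<forall>X Y Z. vector_field M X \<and> vector_field M Y \<and> vector_field M Z \<longrightarrow>
        (\<forall>p\<in>points M. dir_deriv M (X p) (\<lambda>q. k q (Y q) (Z q)) p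
           = k p (nabla X Y p) (Z p) + k p (Y p) (nabla X Z p)))"

definition symmetric_product ::
    "(('m \<Rightarrow> ('m, 'e::real_vector) tvec) \<Rightarrow> ('m \<Rightarrow> ('m, 'e) tvec) \<Rightarrow> 'm \<Rightarrow> ('m, 'e) tvec) \<Rightarrow>
     ('m \<Rightarrow> ('m, 'e) tvec) \<Rightarrow> ('m \<Rightarrow> ('m, 'e) tvec) \<Rightarrow> 'm \<Rightarrow> ('m, 'e) tvec" where
  "symmetric_product nabla X Y p = nabla X Y p + nabla Y X p"


section \<open>Lie groups and principal bundles\<close>

record ('g, 'f) lie_grp = "'g monoid" +
  gmfd :: "('g, 'f) manifold"

definition lie_group :: "('g, 'f::fin_dim_inner) lie_grp \<Rightarrow> bool" where
  "lie_group G \<longleftrightarrow> group G \<and> smooth_manifold (gmfd G) \<and> points (gmfd G) = carrier G \<and>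
     smooth_map (prod_manifold (gmfd G) (gmfd G)) (gmfd G) (\<lambda>(g, h). g \<otimes>\<^bsub>G\<^esub> h) \<and>
     smooth_map (gmfd G) (gmfd G) (\<lambda>g. inv\<^bsub>G\<^esub> g)"

text \<open>Only the vector space structure of the Lie algebra is needed.\<close>

definition lie_algebra :: "('g, 'f::real_normed_vector) lie_grp \<Rightarrow> ('g, 'f) tvec set" where
  "lie_algebra G = tangent_space (gmfd G) \<one>\<^bsub>G\<^esub>"

definition Ad :: "('g, 'f::real_normed_vector) lie_grp \<Rightarrow> 'g \<Rightarrow> ('g, 'f) tvec \<Rightarrow> ('g, 'f) tvec" where
  "Ad G g \<xi> = tangent_map (gmfd G) (gmfd G) (\<lambda>h. g \<otimes>\<^bsub>G\<^esub> h \<otimes>\<^bsub>G\<^esub> inv\<^bsub>G\<^esub> g) \<one>\<^bsub>G\<^esub> \<xi>"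

definition smooth_action ::
    "('g, 'f::real_normed_vector) lie_grp \<Rightarrow> ('m, 'e::real_normed_vector) manifold \<Rightarrow>
     ('g \<Rightarrow> 'm \<Rightarrow> 'm) \<Rightarrow> bool" where
  "smooth_action G M \<phi> \<longleftrightarrow> group_action G (points M) \<phi> \<and>
     smooth_map (prod_manifold (gmfd G) M) M (\<lambda>(g, x). \<phi> g x)"

definition free_action :: "('g, 'f) lie_grp \<Rightarrow> ('m, 'e) manifold \<Rightarrow> ('g \<Rightarrow> 'm \<Rightarrow> 'm) \<Rightarrow> bool" where
  "free_action G M \<phi> \<longleftrightarrow> (\<forall>x\<in>points M. stabilizer G \<phi> x = {\<one>\<^bsub>G\<^esub>})"

definition proper_action :: "('g, 'f) lie_grp \<Rightarrow> ('m, 'e) manifold \<Rightarrow> ('g \<Rightarrow> 'm \<Rightarrow> 'm) \<Rightarrow> bool" where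
  "proper_action G M \<phi> \<longleftrightarrow>
     proper_map (prod_topology (mtop (gmfd G)) (mtop M)) (prod_topology (mtop M) (mtop M))
       (\<lambda>(g, x). (\<phi> g x, x))"

text \<open>\<open>Q\<close> is the orbit space \<open>M/G\<close> with the manifold structure that makes the projection
  \<open>x \<mapsto> orbit G \<phi> x\<close> a principal \<open>G\<close>-bundle. Topology and smooth structure of \<open>Q\<close> are uniquely
  determined by this property, as the projection becomes a surjective submersion.\<close>

definition principal_bundle ::
    "('g, 'f::real_normed_vector) lie_grp \<Rightarrow> ('m, 'e::real_normed_vector) manifold \<Rightarrow>
     ('m set, 'b::fin_dim_inner) manifold \<Rightarrow> ('g \<Rightarrow> 'm \<Rightarrow> 'm) \<Rightarrow> bool" where
  "principal_bundle G M Q \<phi> \<longleftrightarrow>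
     smooth_manifold Q \<and> points Q = orbits G (points M) \<phi> \<and> smooth_map M Q (orbit G \<phi>) \<and>
     (\<forall>b\<in>points Q. \<exists>U \<Phi>. openin (mtop Q) U \<and> b \<in> U \<and>
        diffeomorphism (prod_manifold (open_submanifold Q U) (gmfd G))
          (open_submanifold M {x \<in> points M. orbit G \<phi> x \<in> U}) \<Phi> \<and>
        (\<forall>u\<in>U. \<forall>h\<in>carrier G. orbit G \<phi> (\<Phi> (u, h)) = u \<and>
           (\<forall>g\<in>carrier G. \<phi> g (\<Phi> (u, h)) = \<Phi> (u, g \<otimes>\<^bsub>G\<^esub> h))))"

text \<open>The infinitesimal generator \<open>\<xi>\<^sub>M(x) = d/dt exp(t\<xi>)\<cdot>x\<close> at \<open>t = 0\<close>, i.e. the image of \<open>\<xi>\<close> under the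
  tangent map at the identity of \<open>g \<mapsto> g\<cdot>x\<close>.\<close>

definition inf_generator ::
    "('g, 'f::real_normed_vector) lie_grp \<Rightarrow> ('m, 'e::real_normed_vector) manifold \<Rightarrow>
     ('g \<Rightarrow> 'm \<Rightarrow> 'm) \<Rightarrow> ('g, 'f) tvec \<Rightarrow> 'm \<Rightarrow> ('m, 'e) tvec" where
  "inf_generator G M \<phi> \<xi> x = tangent_map (gmfd G) M (\<lambda>g. \<phi> g x) \<one>\<^bsub>G\<^esub> \<xi>"

definition invariant_field ::
    "('g, 'f) lie_grp \<Rightarrow> ('m, 'e::real_normed_vector) manifold \<Rightarrow> ('g \<Rightarrow> 'm \<Rightarrow> 'm) \<Rightarrow>
     ('m \<Rightarrow> ('m, 'e) tvec) \<Rightarrow> bool" where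
  "invariant_field G M \<phi> X \<longleftrightarrow>
     (\<forall>g\<in>carrier G. \<forall>x\<in>points M. X (\<phi> g x) = tangent_map M M (\<phi> g) x (X x))"

definition invariant_metric ::
    "('g, 'f) lie_grp \<Rightarrow> ('m, 'e::real_normed_vector) manifold \<Rightarrow> ('g \<Rightarrow> 'm \<Rightarrow> 'm) \<Rightarrow>
     ('m \<Rightarrow> ('m, 'e) tvec \<Rightarrow> ('m, 'e) tvec \<Rightarrow> real) \<Rightarrow> bool" where
  "invariant_metric G M \<phi> k \<longleftrightarrow>
     (\<forall>g\<in>carrier G. \<forall>x\<in>points M. \<forall>u\<in>tangent_space M x. \<forall>v\<in>tangent_space M x.
        k (\<phi> g x) (tangent_map M M (\<phi> g) x u) (tangent_map M M (\<phi> g) x v) = k x u v)"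

definition vertical_space ::
    "('g, 'f) lie_grp \<Rightarrow> ('m, 'e::real_normed_vector) manifold \<Rightarrow>
     ('m set, 'b::real_normed_vector) manifold \<Rightarrow> ('g \<Rightarrow> 'm \<Rightarrow> 'm) \<Rightarrow> 'm \<Rightarrow> ('m, 'e) tvec set" where
  "vertical_space G M Q \<phi> x = {v \<in> tangent_space M x. tangent_map M Q (orbit G \<phi>) x v = 0}"


section \<open>Principal connections and curvature\<close>

definition principal_connection ::
    "('g, 'f::real_normed_vector) lie_grp \<Rightarrow> ('m, 'e::real_normed_vector) manifold \<Rightarrow>
     ('g \<Rightarrow> 'm \<Rightarrow> 'm) \<Rightarrow> ('m \<Rightarrow> ('m, 'e) tvec \<Rightarrow> ('g, 'f) tvec) \<Rightarrow> bool" where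
  "principal_connection G M \<phi> A \<longleftrightarrow>
     (\<forall>x\<in>points M. \<forall>u\<in>tangent_space M x.
        A x u \<in> lie_algebra G \<and>
        (\<forall>v\<in>tangent_space M x. A x (u + v) = A x u + A x v) \<and>
        (\<forall>a. A x (tscale a u) = tscale a (A x u)) \<and>
        (\<forall>g\<in>carrier G. A (\<phi> g x) (tangent_map M M (\<phi> g) x u) = Ad G g (A x u))) \<and>
     (\<forall>x\<in>points M. \<forall>\<xi>\<in>lie_algebra G. A x (inf_generator G M \<phi> \<xi> x) = \<xi>) \<and>
     (\<forall>c\<in>atlas M. \<forall>d\<in>charts_at (gmfd G) \<one>\<^bsub>G\<^esub>. \<forall>u. smooth_on (snd c ` fst c)
        (\<lambda>y. let p = chart_inv c y in A p (coord_tvec M c p u) d))"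

definition horizontal_space ::
    "('m, 'e::real_normed_vector) manifold \<Rightarrow> ('m \<Rightarrow> ('m, 'e) tvec \<Rightarrow> ('g, 'f::zero) tvec) \<Rightarrow>
     'm \<Rightarrow> ('m, 'e) tvec set" where
  "horizontal_space M A x = {v \<in> tangent_space M x. A x v = 0}"

definition mechanical_connection ::
    "('g, 'f::real_normed_vector) lie_grp \<Rightarrow> ('m, 'e::real_normed_vector) manifold \<Rightarrow>
     ('m set, 'b::real_normed_vector) manifold \<Rightarrow> ('g \<Rightarrow> 'm \<Rightarrow> 'm) \<Rightarrow>
     ('m \<Rightarrow> ('m, 'e) tvec \<Rightarrow> ('m, 'e) tvec \<Rightarrow> real) \<Rightarrow>
     ('m \<Rightarrow> ('m, 'e) tvec \<Rightarrow> ('g, 'f) tvec) \<Rightarrow> bool" where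
  "mechanical_connection G M Q \<phi> k A \<longleftrightarrow> principal_connection G M \<phi> A \<and>
     (\<forall>x\<in>points M. horizontal_space M A x
        = {v \<in> tangent_space M x. \<forall>w\<in>vertical_space G M Q \<phi> x. k x v w = 0})"

definition hlift_at ::
    "('g, 'f::real_normed_vector) lie_grp \<Rightarrow> ('m, 'e::real_normed_vector) manifold \<Rightarrow>
     ('m set, 'b::real_normed_vector) manifold \<Rightarrow> ('g \<Rightarrow> 'm \<Rightarrow> 'm) \<Rightarrow>
     ('m \<Rightarrow> ('m, 'e) tvec \<Rightarrow> ('g, 'f) tvec) \<Rightarrow> 'm \<Rightarrow> ('m set, 'b) tvec \<Rightarrow> ('m, 'e) tvec" where
  "hlift_at G M Q \<phi> A x w =
     (THE v. v \<in> horizontal_space M A x \<and> tangent_map M Q (orbit G \<phi>) x v = w)"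

definition horizontal_lift ::
    "('g, 'f::real_normed_vector) lie_grp \<Rightarrow> ('m, 'e::real_normed_vector) manifold \<Rightarrow>
     ('m set, 'b::real_normed_vector) manifold \<Rightarrow> ('g \<Rightarrow> 'm \<Rightarrow> 'm) \<Rightarrow>
     ('m \<Rightarrow> ('m, 'e) tvec \<Rightarrow> ('g, 'f) tvec) \<Rightarrow>
     ('m set \<Rightarrow> ('m set, 'b) tvec) \<Rightarrow> ('m \<Rightarrow> ('m, 'e) tvec) \<Rightarrow> bool" where
  "horizontal_lift G M Q \<phi> A Xq X \<longleftrightarrow> vector_field Q Xq \<and> vector_field M X \<and>
     (\<forall>x\<in>points M. X x = hlift_at G M Q \<phi> A x (Xq (orbit G \<phi> x)))"

text \<open>The value at \<open>(u, v)\<close> of the curvature form is given by the vertical part of the bracket of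
  horizontal lifts, with the sign convention
  \<open>[X\<^sup>h, Y\<^sup>h](x) = [X, Y]\<^sup>h(x) - (B\<^sub>A(X\<^sup>h(x), Y\<^sup>h(x)))\<^sub>M(x)\<close>. It depends on the
  horizontal parts of \<open>u\<close> and \<open>v\<close> only.\<close>

definition curvature_form ::
    "('g, 'f::real_normed_vector) lie_grp \<Rightarrow> ('m, 'e::real_normed_vector) manifold \<Rightarrow>
     ('m set, 'b::real_normed_vector) manifold \<Rightarrow> ('g \<Rightarrow> 'm \<Rightarrow> 'm) \<Rightarrow>
     ('m \<Rightarrow> ('m, 'e) tvec \<Rightarrow> ('g, 'f) tvec) \<Rightarrow>
     'm \<Rightarrow> ('m, 'e) tvec \<Rightarrow> ('m, 'e) tvec \<Rightarrow> ('g, 'f) tvec" where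
  "curvature_form G M Q \<phi> A x u v =
     (THE \<beta>. \<beta> \<in> lie_algebra G \<and>
        (\<forall>Xq Yq X Y. horizontal_lift G M Q \<phi> A Xq X \<and> horizontal_lift G M Q \<phi> A Yq Y \<and>
           X x = u - inf_generator G M \<phi> (A x u) x \<and> Y x = v - inf_generator G M \<phi> (A x v) x \<longrightarrow>
           lie_bracket M X Y x
             = hlift_at G M Q \<phi> A x (lie_bracket Q Xq Yq (orbit G \<phi> x)) - inf_generator G M \<phi> \<beta> x))"

end

theory Submission
  imports Defs
begin

text \<open>By the Koszul formula \<open>k(\<langle>X\<^sup>h : V\<rangle>, Y\<^sup>h) = - k([X\<^sup>h, Y\<^sup>h], V)\<close> at \<open>x\<close>: \<open>k(X\<^sup>h, V)\<close> and \<open>k(Y\<^sup>h, V)\<close>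
  vanish, \<open>k(X\<^sup>h, Y\<^sup>h)\<close> is constant along the orbits, to which \<open>V\<close> is tangent, and brackets of horizontal
  lifts with vertical fields are vertical, because brackets are preserved by projection to \<open>M/G\<close>. By
  orthogonality only the vertical part of \<open>[X\<^sup>h, Y\<^sup>h]\<close> contributes, and this is minus the generator of the
  curvature. That the description defining the curvature form has a unique solution amounts to
  \<open>A[X, Y](x)\<close> depending only on \<open>X(x)\<close> and \<open>Y(x)\<close> for horizontal \<open>X\<close> and \<open>Y\<close>, and to the
  surjectivity of the differential of the projection.\<close>

section \<open>Calculus in finite-dimensional spaces\<close>

text \<open>The obstacle is that smoothness of \<open>k\<close> and \<open>A\<close> is given only
  in charts and only on vectors with constant coordinates, whereas the argument differentiates
  \<open>k q (X q) (Y q)\<close> and the vanishing function \<open>A q (X q)\<close>. Both are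
  evaluations of a family of linear maps at a moving argument, and so is the relation between a
  field and its projection; one product rule for linear families therefore carries the analysis. For
  the curvature, differentiating \<open>A(X) = 0\<close> trades the derivative of \<open>X\<close>,
  which depends on the whole field, for a derivative of \<open>A\<close> with the vector
  \<open>X(x)\<close> frozen. The vertical space is the kernel of the differential of the projection
  and is never rewritten as the set of generators: a vector is split by subtracting the generator of
  its \<open>A\<close>-value, which leaves a horizontal vector, orthogonal to that kernel.\<close>

lemma fin_dim_expansion:
  "\<exists>B (\<beta> :: 'a \<Rightarrow> 'a). finite B \<and> (\<forall>x::'a::fin_dim_inner. x = (\<Sum>b\<in>B. (x \<bullet> \<beta> b) *\<^sub>R b))"
proof -
  obtain B :: "'a set" where B: "finite B" "span B = UNIV"
    using ex_finite_spanning by blast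
  obtain C where C: "finite C" "span C = span B" "pairwise orthogonal C"
    using basis_orthogonal[OF B(1)] by blast
  \<comment> \<open>On nonzero vectors of \<open>C\<close> this is the dual family. \<open>C\<close>
    may contain 0, where \<open>1 / (c \<bullet> c)\<close> is 0 and the term drops out.\<close>
  define \<beta> where "\<beta> c = (1 / (c \<bullet> c)) *\<^sub>R c" for c :: 'a
  have "x = (\<Sum>c\<in>C. (x \<bullet> \<beta> c) *\<^sub>R c)" for x :: 'a
  proof -
    define p where "p = (\<Sum>c\<in>C. (x \<bullet> \<beta> c) *\<^sub>R c)"
    have "orthogonal (x - p) c" if c: "c \<in> C" for c
    proof -
      have "p \<bullet> c = (\<Sum>d\<in>C. if d = c then (x \<bullet> \<beta> c) * (c \<bullet> c) else 0)"
        unfolding p_def inner_sum_left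
        using C(3) c by (intro sum.cong) (auto simp: pairwise_def orthogonal_def)
      also have "\<dots> = x \<bullet> c"
        using C(1) c by (simp add: \<beta>_def)
      finally show ?thesis
        by (simp add: orthogonal_def inner_diff_left)
    qed
    then have "orthogonal (x - p) (x - p)"
      using orthogonal_to_span[of "x - p" C "x - p"] C(2) B(2) by simp
    then show ?thesis
      by (simp add: orthogonal_def p_def)
  qed
  then show ?thesis
    using C(1) by blast
qed

text \<open>Expanding the moving argument in a finite family turns \<open>L y (X y)\<close> into a
  finite sum of real coefficients times the functions \<open>L y b\<close>. Hence differentiability
  for each constant argument suffices, and no norm on the space of linear maps enters. It is applied
  to the derivative of a map, to the metric and to the connection form.\<close>

lemma has_derivative_linear_family:
  fixes L :: "'x::real_normed_vector \<Rightarrow> 'a::fin_dim_inner \<Rightarrow> 'v::real_normed_vector"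
  assumes lin: "\<And>y. y \<in> S \<Longrightarrow> linear (L y)" and S: "open S" "x \<in> S"
    and L: "\<And>u. (\<lambda>y. L y u) differentiable (at x)"
    and X: "(X has_derivative X') (at x)"
  shows "((\<lambda>y. L y (X y)) has_derivative
           (\<lambda>w. L x (X' w) + frechet_derivative (\<lambda>y. L y (X x)) (at x) w)) (at x)"
proof -
  obtain B and \<beta> :: "'a \<Rightarrow> 'a" where B: "finite B" "\<And>u::'a. u = (\<Sum>b\<in>B. (u \<bullet> \<beta> b) *\<^sub>R b)"
    using fin_dim_expansion by metis
  have exp: "L y u = (\<Sum>b\<in>B. (u \<bullet> \<beta> b) *\<^sub>R L y b)" if "y \<in> S" for y u
    by (subst B(2)) (simp add: linear_sum[OF lin[OF that]] linear_cmul[OF lin[OF that]])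
  define D where "D b = frechet_derivative (\<lambda>y. L y b) (at x)" for b
  have D [derivative_intros]: "((\<lambda>y. L y b) has_derivative D b) (at x)" for b
    using L frechet_derivative_works unfolding D_def by blast
  note [derivative_intros] = X
  have inn: "((\<lambda>y. X y \<bullet> \<beta> b) has_derivative (\<lambda>w. X' w \<bullet> \<beta> b)) (at x)" for b
    by (rule bounded_linear.has_derivative[OF bounded_linear_inner_left X])
  have "((\<lambda>y. \<Sum>b\<in>B. (X x \<bullet> \<beta> b) *\<^sub>R L y b) has_derivative
          (\<lambda>w. \<Sum>b\<in>B. (X x \<bullet> \<beta> b) *\<^sub>R D b w)) (at x)"
    by (auto intro!: derivative_eq_intros)
  then have "((\<lambda>y. L y (X x)) has_derivative (\<lambda>w. \<Sum>b\<in>B. (X x \<bullet> \<beta> b) *\<^sub>R D b w)) (at x)"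
    by (rule has_derivative_transform_within_open[OF _ S]) (simp add: exp)
  then have frozen: "frechet_derivative (\<lambda>y. L y (X x)) (at x) = (\<lambda>w. \<Sum>b\<in>B. (X x \<bullet> \<beta> b) *\<^sub>R D b w)"
    using frechet_derivative_at by metis
  have "((\<lambda>y. \<Sum>b\<in>B. (X y \<bullet> \<beta> b) *\<^sub>R L y b) has_derivative
          (\<lambda>w. \<Sum>b\<in>B. (X x \<bullet> \<beta> b) *\<^sub>R D b w + (X' w \<bullet> \<beta> b) *\<^sub>R L x b)) (at x)"
    by (intro has_derivative_sum has_derivative_scaleR inn D)
  moreover have "(\<lambda>w. \<Sum>b\<in>B. (X x \<bullet> \<beta> b) *\<^sub>R D b w + (X' w \<bullet> \<beta> b) *\<^sub>R L x b) =
     (\<lambda>w. L x (X' w) + frechet_derivative (\<lambda>y. L y (X x)) (at x) w)"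
    using S by (simp add: frozen exp sum.distrib add.commute)
  ultimately have "((\<lambda>y. \<Sum>b\<in>B. (X y \<bullet> \<beta> b) *\<^sub>R L y b) has_derivative
      (\<lambda>w. L x (X' w) + frechet_derivative (\<lambda>y. L y (X x)) (at x) w)) (at x)"
    by simp
  then show ?thesis
    by (rule has_derivative_transform_within_open[OF _ S]) (simp add: exp)
qed

section \<open>Smooth maps and the symmetry of second derivatives\<close>

lemma smooth_on_differentiable:
  "smooth_on S f \<Longrightarrow> x \<in> S \<Longrightarrow> f differentiable (at x)"
  unfolding smooth_on_def using Ck_on.simps(2)[of 0 S f] by blast

lemma smooth_on_has_derivative:
  "smooth_on S f \<Longrightarrow> x \<in> S \<Longrightarrow> (f has_derivative frechet_derivative f (at x)) (at x)"
  using smooth_on_differentiable frechet_derivative_works by blast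

lemma smooth_on_frechet_derivative:
  "smooth_on S f \<Longrightarrow> smooth_on S (\<lambda>x. frechet_derivative f (at x) v)"
  unfolding smooth_on_def using Ck_on.simps(2) by blast

lemma smooth_on_const: "smooth_on S (\<lambda>x. c)"
proof -
  have "Ck_on k S (\<lambda>x. c)" for k and c :: 'b
    by (induction k arbitrary: c) auto
  then show ?thesis
    by (simp add: smooth_on_def)
qed

text \<open>The mean value theorem is applied first in direction \<open>u\<close>, then in direction \<open>v\<close>.\<close>

lemma second_difference_quotient:
  fixes f :: "'a::real_normed_vector \<Rightarrow> 'b::real_inner"
  assumes f: "smooth_on S f" and S: "open S" "x \<in> S" and e: "e > 0"
  shows "\<exists>d>0. \<forall>s. 0 < s \<and> s < d \<longrightarrow>
    \<bar>((f (x + s *\<^sub>R u + s *\<^sub>R v) - f (x + s *\<^sub>R u) - f (x + s *\<^sub>R v) + f x) \<bullet> w) / s\<^sup>2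
      - frechet_derivative (\<lambda>y. frechet_derivative f (at y) u) (at x) v \<bullet> w\<bar> < e"
proof -
  define f1 where "f1 y = frechet_derivative f (at y) u" for y
  define f2 where "f2 y = frechet_derivative f1 (at y) v" for y
  have f1: "smooth_on S f1"
    using smooth_on_frechet_derivative[OF f] by (simp add: f1_def[abs_def])
  have "smooth_on S f2"
    using smooth_on_frechet_derivative[OF f1] by (simp add: f2_def[abs_def])
  then have "continuous_on S f2"
    unfolding smooth_on_def using Ck_on.simps(1) by blast
  then have "continuous_on S (\<lambda>y. f2 y \<bullet> w)"
    by (intro continuous_intros)
  then have "isCont (\<lambda>y. f2 y \<bullet> w) x"
    using S continuous_on_eq_continuous_at by blast
  then obtain r0 where r0: "r0 > 0" "\<And>y. dist y x < r0 \<Longrightarrow> dist (f2 y \<bullet> w) (f2 x \<bullet> w) < e"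
    unfolding continuous_at_eps_delta using e by meson
  obtain r1 where r1: "r1 > 0" "ball x r1 \<subseteq> S"
    using S open_contains_ball by blast
  define r where "r = min r0 r1"
  have r: "r > 0" "ball x r \<subseteq> S"
    using r0 r1 by (auto simp: r_def)
  \<comment> \<open>For \<open>s < d\<close> all points of the parallelogram spanned by
    \<open>s *\<^sub>R u\<close> and \<open>s *\<^sub>R v\<close> stay within \<open>r\<close> of
    \<open>x\<close>. The summand 1 keeps the denominator positive when \<open>u\<close> and
    \<open>v\<close> vanish.\<close>
  define d where "d = r / (norm u + norm v + 1)"
  have np: "norm u + norm v + 1 > 0"
    by (smt (verit) norm_ge_zero)
  have d: "d > 0"
    using r np by (simp add: d_def)
  have near: "x + a *\<^sub>R u + b *\<^sub>R v \<in> ball x r" if "0 \<le> a" "a \<le> s" "0 \<le> b" "b \<le> s" "0 < s" "s < d"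
    for a b s
  proof -
    have "norm (a *\<^sub>R u + b *\<^sub>R v) \<le> a * norm u + b * norm v"
      using norm_triangle_ineq[of "a *\<^sub>R u" "b *\<^sub>R v"] that by simp
    also have "\<dots> \<le> s * norm u + s * norm v"
      using that by (intro add_mono mult_right_mono) auto
    also have "\<dots> < s * (norm u + norm v + 1)"
      using that by (simp add: algebra_simps)
    also have "\<dots> < d * (norm u + norm v + 1)"
      using that np by (intro mult_strict_right_mono) auto
    also have "\<dots> = r"
      using np by (simp add: d_def)
    finally show ?thesis
      by (metis add.assoc add_diff_cancel_left' dist_commute dist_norm mem_ball)
  qed
  have "\<bar>((f (x + s *\<^sub>R u + s *\<^sub>R v) - f (x + s *\<^sub>R u) - f (x + s *\<^sub>R v) + f x) \<bullet> w) / s\<^sup>2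
      - f2 x \<bullet> w\<bar> < e" if s: "0 < s" "s < d" for s
  proof -
    \<comment> \<open>Pairing with the fixed vector \<open>w\<close> makes the function real-valued,
      as the mean value theorem requires.\<close>
    have df: "((\<lambda>t. f (x + t *\<^sub>R u + b *\<^sub>R v) \<bullet> w) has_derivative
        (\<lambda>h. h * (f1 (x + t *\<^sub>R u + b *\<^sub>R v) \<bullet> w))) (at t)"
      if "0 \<le> t" "t \<le> s" "0 \<le> b" "b \<le> s" for t b
    proof -
      have in_S: "x + t *\<^sub>R u + b *\<^sub>R v \<in> S"
        using near[OF that s] r(2) by blast
      have "((\<lambda>t. x + t *\<^sub>R u + b *\<^sub>R v) has_derivative (\<lambda>h. h *\<^sub>R u)) (at t)"
        by (auto intro!: derivative_eq_intros)
      from diff_chain_at[OF this smooth_on_has_derivative[OF f in_S]]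
      have "((\<lambda>t. f (x + t *\<^sub>R u + b *\<^sub>R v)) has_derivative
          (\<lambda>h. h *\<^sub>R f1 (x + t *\<^sub>R u + b *\<^sub>R v))) (at t)"
        using linear_frechet_derivative[OF smooth_on_differentiable[OF f in_S]]
        by (simp add: o_def f1_def linear_cmul)
      from bounded_linear.has_derivative[OF bounded_linear_inner_left this, of w]
      show ?thesis by simp
    qed
    have "\<exists>z>0. z < s \<and> (f (x + s *\<^sub>R u + s *\<^sub>R v) \<bullet> w - f (x + s *\<^sub>R u + 0 *\<^sub>R v) \<bullet> w)
          - (f (x + 0 *\<^sub>R u + s *\<^sub>R v) \<bullet> w - f (x + 0 *\<^sub>R u + 0 *\<^sub>R v) \<bullet> w)
        = (s - 0) * (f1 (x + z *\<^sub>R u + s *\<^sub>R v) \<bullet> w - f1 (x + z *\<^sub>R u + 0 *\<^sub>R v) \<bullet> w)"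
    proof (rule MVT2[OF s(1)])
      fix t assume "0 \<le> t" "t \<le> s"
      then show "((\<lambda>t. f (x + t *\<^sub>R u + s *\<^sub>R v) \<bullet> w - f (x + t *\<^sub>R u + 0 *\<^sub>R v) \<bullet> w) has_real_derivative
        f1 (x + t *\<^sub>R u + s *\<^sub>R v) \<bullet> w - f1 (x + t *\<^sub>R u + 0 *\<^sub>R v) \<bullet> w) (at t)"
        using s unfolding has_field_derivative_def
        by (intro has_derivative_eq_rhs[OF has_derivative_diff[OF df df]])
          (auto simp: fun_eq_iff left_diff_distrib right_diff_distrib mult.commute)
    qed
    then obtain z where z: "0 < z" "z < s" and
      E1: "(f (x + s *\<^sub>R u + s *\<^sub>R v) - f (x + s *\<^sub>R u) - f (x + s *\<^sub>R v) + f x) \<bullet> w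
        = s * (f1 (x + z *\<^sub>R u + s *\<^sub>R v) \<bullet> w - f1 (x + z *\<^sub>R u + 0 *\<^sub>R v) \<bullet> w)"
      by (auto simp: inner_diff_left inner_add_left)
    have "\<exists>y>0. y < s \<and> f1 (x + z *\<^sub>R u + s *\<^sub>R v) \<bullet> w - f1 (x + z *\<^sub>R u + 0 *\<^sub>R v) \<bullet> w
        = (s - 0) * (f2 (x + z *\<^sub>R u + y *\<^sub>R v) \<bullet> w)"
    proof (rule MVT2[OF s(1)])
      fix t assume t: "0 \<le> t" "t \<le> s"
      have in_S: "x + z *\<^sub>R u + t *\<^sub>R v \<in> S"
        using near[of z s t] z t s r(2) by auto
      have "((\<lambda>t. x + z *\<^sub>R u + t *\<^sub>R v) has_derivative (\<lambda>h. h *\<^sub>R v)) (at t)"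
        by (auto intro!: derivative_eq_intros)
      from diff_chain_at[OF this smooth_on_has_derivative[OF f1 in_S]]
      have "((\<lambda>t. f1 (x + z *\<^sub>R u + t *\<^sub>R v)) has_derivative
          (\<lambda>h. h *\<^sub>R f2 (x + z *\<^sub>R u + t *\<^sub>R v))) (at t)"
        using linear_frechet_derivative[OF smooth_on_differentiable[OF f1 in_S]]
        by (simp add: o_def f2_def linear_cmul)
      from bounded_linear.has_derivative[OF bounded_linear_inner_left this, of w]
      show "((\<lambda>t. f1 (x + z *\<^sub>R u + t *\<^sub>R v) \<bullet> w) has_real_derivative
        f2 (x + z *\<^sub>R u + t *\<^sub>R v) \<bullet> w) (at t)"
        by (simp add: has_field_derivative_def mult_commute_abs)
    qed
    then obtain y where y: "0 < y" "y < s" and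
      E2: "f1 (x + z *\<^sub>R u + s *\<^sub>R v) \<bullet> w - f1 (x + z *\<^sub>R u + 0 *\<^sub>R v) \<bullet> w
        = s * (f2 (x + z *\<^sub>R u + y *\<^sub>R v) \<bullet> w)"
      by auto
    have "dist (f2 (x + z *\<^sub>R u + y *\<^sub>R v) \<bullet> w) (f2 x \<bullet> w) < e"
      using near[of z s y] z y s by (intro r0) (auto simp: r_def dist_commute)
    then show ?thesis
      unfolding E1 E2 using s by (simp add: power2_eq_square dist_real_def)
  qed
  then show ?thesis
    using d unfolding f2_def f1_def[abs_def] by blast
qed

text \<open>The second difference quotient does not change when \<open>u\<close> and
  \<open>v\<close> are swapped, yet it comes arbitrarily close to either mixed derivative. If these
  differed after pairing with some \<open>w\<close>, half their distance as tolerance would be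
  contradictory.\<close>

lemma frechet_derivative_symmetric:
  fixes f :: "'a::real_normed_vector \<Rightarrow> 'b::real_inner"
  assumes f: "smooth_on S f" and S: "open S" "x \<in> S"
  shows "frechet_derivative (\<lambda>y. frechet_derivative f (at y) u) (at x) v
       = frechet_derivative (\<lambda>y. frechet_derivative f (at y) v) (at x) u"
proof (rule vector_eq_rdot[THEN iffD1], rule allI, rule ccontr)
  fix w
  let ?a = "frechet_derivative (\<lambda>y. frechet_derivative f (at y) u) (at x) v \<bullet> w"
  let ?b = "frechet_derivative (\<lambda>y. frechet_derivative f (at y) v) (at x) u \<bullet> w"
  assume "?a \<noteq> ?b"
  then have e: "\<bar>?a - ?b\<bar> / 2 > 0"
    by simp
  define Q where
    "Q s = ((f (x + s *\<^sub>R u + s *\<^sub>R v) - f (x + s *\<^sub>R u) - f (x + s *\<^sub>R v) + f x) \<bullet> w) / s\<^sup>2" for s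
  have Q_sym:
    "Q s = ((f (x + s *\<^sub>R v + s *\<^sub>R u) - f (x + s *\<^sub>R v) - f (x + s *\<^sub>R u) + f x) \<bullet> w) / s\<^sup>2" for s
    by (simp add: Q_def inner_diff_left inner_add_left algebra_simps)
  obtain d1 where d1: "d1 > 0" "\<And>s. 0 < s \<Longrightarrow> s < d1 \<Longrightarrow> \<bar>Q s - ?a\<bar> < \<bar>?a - ?b\<bar> / 2"
    using second_difference_quotient[OF f S e, of u v w] unfolding Q_def by blast
  obtain d2 where d2: "d2 > 0" "\<And>s. 0 < s \<Longrightarrow> s < d2 \<Longrightarrow> \<bar>Q s - ?b\<bar> < \<bar>?a - ?b\<bar> / 2"
    using second_difference_quotient[OF f S e, of v u w] unfolding Q_sym by blast
  obtain s where "0 < s" "s < d1" "s < d2"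
    using field_lbound_gt_zero[OF d1(1) d2(1)] by blast
  then have "\<bar>Q s - ?a\<bar> < \<bar>?a - ?b\<bar> / 2" "\<bar>Q s - ?b\<bar> < \<bar>?a - ?b\<bar> / 2"
    using d1(2) d2(2) by blast+
  then show False
    by (smt (verit) field_sum_of_halves)
qed

text \<open>The second derivatives of \<open>F\<close> cancel by symmetry.\<close>

lemma related_bracket_coord:
  fixes F :: "'a::fin_dim_inner \<Rightarrow> 'b::real_inner"
  assumes F: "smooth_on S F" and S: "open S" "x \<in> S"
    and X: "X differentiable (at x)" and Y: "Y differentiable (at x)"
    and X1: "X1 differentiable (at (F x))" and Y1: "Y1 differentiable (at (F x))"
    and rX: "\<And>y. y \<in> S \<Longrightarrow> frechet_derivative F (at y) (X y) = X1 (F y)"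
    and rY: "\<And>y. y \<in> S \<Longrightarrow> frechet_derivative F (at y) (Y y) = Y1 (F y)"
  shows "frechet_derivative F (at x)
           (frechet_derivative Y (at x) (X x) - frechet_derivative X (at x) (Y x))
       = frechet_derivative Y1 (at (F x)) (X1 (F x)) - frechet_derivative X1 (at (F x)) (Y1 (F x))"
proof -
  let ?D = "\<lambda>y. frechet_derivative F (at y)"
  have lin: "linear (?D y)" if "y \<in> S" for y
    using linear_frechet_derivative[OF smooth_on_differentiable[OF F that]] .
  have diff: "(\<lambda>y. ?D y u) differentiable (at x)" for u
    using smooth_on_differentiable[OF smooth_on_frechet_derivative[OF F] S(2)] .
  \<comment> \<open>The relation \<open>DF(Z) = Z1 o F\<close> is differentiated on both sides: the
    product rule for linear families on the left, the chain rule on the right.\<close>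
  have *: "?D x (frechet_derivative Z (at x) w) + frechet_derivative (\<lambda>y. ?D y (Z x)) (at x) w
      = frechet_derivative Z1 (at (F x)) (?D x w)"
    if Z: "Z differentiable (at x)" and Z1: "Z1 differentiable (at (F x))"
      and r: "\<And>y. y \<in> S \<Longrightarrow> ?D y (Z y) = Z1 (F y)" for Z Z1 w
  proof -
    have "((\<lambda>y. ?D y (Z y)) has_derivative (\<lambda>w. ?D x (frechet_derivative Z (at x) w)
        + frechet_derivative (\<lambda>y. ?D y (Z x)) (at x) w)) (at x)"
      using Z by (intro has_derivative_linear_family[OF lin S diff])
        (simp_all add: frechet_derivative_works[symmetric])
    then have "((\<lambda>y. Z1 (F y)) has_derivative (\<lambda>w. ?D x (frechet_derivative Z (at x) w)
        + frechet_derivative (\<lambda>y. ?D y (Z x)) (at x) w)) (at x)"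
      by (rule has_derivative_transform_within_open[OF _ S r])
    moreover have "((\<lambda>y. Z1 (F y)) has_derivative (\<lambda>w. frechet_derivative Z1 (at (F x)) (?D x w))) (at x)"
      using diff_chain_at[OF smooth_on_has_derivative[OF F S(2)], of Z1] Z1
      by (simp add: frechet_derivative_works o_def)
    ultimately have "(\<lambda>w. ?D x (frechet_derivative Z (at x) w) + frechet_derivative (\<lambda>y. ?D y (Z x)) (at x) w)
        = (\<lambda>w. frechet_derivative Z1 (at (F x)) (?D x w))"
      by (rule has_derivative_unique)
    then show ?thesis
      by (rule fun_cong)
  qed
  have "?D x (frechet_derivative Y (at x) (X x)) - ?D x (frechet_derivative X (at x) (Y x))
      = (?D x (frechet_derivative Y (at x) (X x)) + frechet_derivative (\<lambda>y. ?D y (Y x)) (at x) (X x))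
        - (?D x (frechet_derivative X (at x) (Y x)) + frechet_derivative (\<lambda>y. ?D y (X x)) (at x) (Y x))"
    unfolding frechet_derivative_symmetric[OF F S, of "X x" "Y x"] by (rule add_diff_cancel_right[symmetric])
  also have "\<dots> = frechet_derivative Y1 (at (F x)) (X1 (F x)) - frechet_derivative X1 (at (F x)) (Y1 (F x))"
    using *[OF X X1 rX, of "Y x"] *[OF Y Y1 rY, of "X x"] by (simp add: rX rY S)
  finally show ?thesis
    unfolding linear_diff[OF lin[OF S(2)]] .
qed

section \<open>Tangent vectors in coordinates\<close>

lemma charts_atD:
  "c \<in> charts_at M p \<Longrightarrow> c \<in> atlas M" "c \<in> charts_at M p \<Longrightarrow> p \<in> fst c"
  by (auto simp: charts_at_def)

lemma chart_inv_snd: "inj_on (snd c) (fst c) \<Longrightarrow> p \<in> fst c \<Longrightarrow> chart_inv c (snd c p) = p"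
  by (simp add: chart_inv_def)

lemma openin_chart_domain: "smooth_manifold M \<Longrightarrow> c \<in> atlas M \<Longrightarrow> openin (mtop M) (fst c)"
  by (simp add: smooth_manifold_def)

lemma chart_domain_subset: "smooth_manifold M \<Longrightarrow> c \<in> atlas M \<Longrightarrow> fst c \<subseteq> points M"
  by (simp add: openin_chart_domain openin_subset)

lemma inj_on_chart:
  assumes "smooth_manifold M" "c \<in> atlas M"
  shows "inj_on (snd c) (fst c)"
proof -
  have "homeomorphic_map (subtopology (mtop M) (fst c)) (top_of_set (snd c ` fst c)) (snd c)"
    using assms by (simp add: smooth_manifold_def)
  from homeomorphic_imp_injective_map[OF this] show ?thesis
    using chart_domain_subset[OF assms] by (simp add: Int_absorb1)
qed

lemma open_chart_image:
  assumes "smooth_manifold M" "c \<in> atlas M" "openin (mtop M) W"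
  shows "open (snd c ` (fst c \<inter> W))"
proof -
  have h: "homeomorphic_map (subtopology (mtop M) (fst c)) (top_of_set (snd c ` fst c)) (snd c)"
    and o: "open (snd c ` fst c)"
    using assms by (simp_all add: smooth_manifold_def)
  have "openin (subtopology (mtop M) (fst c)) (fst c \<inter> W)"
    using assms(3) by (simp add: openin_subtopology_Int2)
  then have "openin (top_of_set (snd c ` fst c)) (snd c ` (fst c \<inter> W))"
    using homeomorphic_imp_open_map[OF h] by (simp add: open_map_def)
  then show ?thesis
    using o openin_open_trans by blast
qed

lemma charts_at_nonempty:
  "smooth_manifold M \<Longrightarrow> p \<in> points M \<Longrightarrow> charts_at M p \<noteq> {}"
proof -
  assume "smooth_manifold M" "p \<in> points M"
  then have "p \<in> (\<Union>c\<in>atlas M. fst c)"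
    by (simp add: smooth_manifold_def)
  then show ?thesis
    by (auto simp: charts_at_def)
qed

lemma charts_at_points:
  "smooth_manifold M \<Longrightarrow> c \<in> charts_at M p \<Longrightarrow> p \<in> points M"
  by (auto simp: charts_at_def dest: chart_domain_subset)

lemma some_chart_at:
  "smooth_manifold M \<Longrightarrow> p \<in> points M \<Longrightarrow> (SOME c. c \<in> charts_at M p) \<in> charts_at M p"
  by (simp add: charts_at_nonempty some_in_eq)

text \<open>Derivatives are local, so identities between coordinate expressions need checking only
  on such an \<open>N\<close>. It is the chart image of \<open>fst c \<inter> W\<close>, which makes
  room for an additional condition \<open>W\<close> on the points.\<close>

lemma chart_nhd:
  assumes "smooth_manifold M" "c \<in> charts_at M p" "openin (mtop M) W" "p \<in> W"
  obtains N where "open N" "snd c p \<in> N" "N \<subseteq> snd c ` fst c"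
    "\<And>y. y \<in> N \<Longrightarrow> chart_inv c y \<in> fst c \<inter> W" "\<And>y. y \<in> N \<Longrightarrow> snd c (chart_inv c y) = y"
proof
  note c = charts_atD[OF assms(2)]
  show "open (snd c ` (fst c \<inter> W))"
    by (rule open_chart_image[OF assms(1) c(1) assms(3)])
  show "snd c p \<in> snd c ` (fst c \<inter> W)" "snd c ` (fst c \<inter> W) \<subseteq> snd c ` fst c"
    using c assms(4) by auto
  show "chart_inv c y \<in> fst c \<inter> W" "snd c (chart_inv c y) = y" if "y \<in> snd c ` (fst c \<inter> W)" for y
    using that chart_inv_snd[OF inj_on_chart[OF assms(1) c(1)]] by auto
qed

lemma chart_inv_chart_at:
  "smooth_manifold M \<Longrightarrow> c \<in> charts_at M p \<Longrightarrow> chart_inv c (snd c p) = p"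
  by (rule chart_inv_snd[OF inj_on_chart]) (auto simp: charts_at_def)

lemma differentiable_transform_open:
  assumes "f differentiable (at x)" "open N" "x \<in> N" "\<And>y. y \<in> N \<Longrightarrow> f y = g y"
  shows "g differentiable (at x)"
  using assms has_derivative_transform_within_open unfolding differentiable_def by blast

text \<open>\<open>frechet_derivative\<close> is a choice among the derivatives of a function, so it
  suffices that both functions have the same ones. This covers functions without any derivative as
  well.\<close>

lemma frechet_derivative_cong_open:
  assumes "open N" "x \<in> N" "\<And>y. y \<in> N \<Longrightarrow> f y = g y"
  shows "frechet_derivative f (at x) = frechet_derivative g (at x)"
proof -
  have "(f has_derivative f') (at x) \<longleftrightarrow> (g has_derivative f') (at x)" for f'
    using assms has_derivative_transform_within_open[of f f' x UNIV N g]
      has_derivative_transform_within_open[of g f' x UNIV N f] by auto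
  then show ?thesis
    by (simp add: frechet_derivative_def)
qed

lemma transition_differentiable:
  assumes "smooth_manifold M" "c \<in> charts_at M p" "d \<in> charts_at M p"
  shows "transition c d differentiable (at (snd c p))"
proof (rule smooth_on_differentiable)
  show "smooth_on (snd c ` (fst c \<inter> fst d)) (transition c d)"
    using assms by (simp add: smooth_manifold_def charts_at_def)
qed (use assms in \<open>auto simp: charts_at_def\<close>)

lemma linear_transition:
  "smooth_manifold M \<Longrightarrow> c \<in> charts_at M p \<Longrightarrow> d \<in> charts_at M p \<Longrightarrow>
    linear (frechet_derivative (transition c d) (at (snd c p)))"
  by (simp add: linear_frechet_derivative transition_differentiable)

lemma transition_at:
  "smooth_manifold M \<Longrightarrow> c \<in> charts_at M p \<Longrightarrow> transition c d (snd c p) = snd d p"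
  by (simp add: transition_def chart_inv_chart_at)

lemma transition_self_derivative:
  assumes "smooth_manifold M" "c \<in> charts_at M p"
  shows "frechet_derivative (transition c c) (at (snd c p)) u = u"
proof -
  obtain N where N: "open N" "snd c p \<in> N" "\<And>y. y \<in> N \<Longrightarrow> snd c (chart_inv c y) = y"
    using chart_nhd[OF assms openin_topspace charts_at_points[OF assms]] by metis
  have "frechet_derivative (transition c c) (at (snd c p)) = frechet_derivative (\<lambda>y. y) (at (snd c p))"
    by (rule frechet_derivative_cong_open[OF N(1,2)]) (simp add: transition_def N)
  then show ?thesis
    by simp
qed

text \<open>Near \<open>snd c p\<close> the expression of \<open>f\<close> in \<open>c\<close> is
  its expression in \<open>d\<close> after the transition map, and the chain rule applies. This is
  why the chart picked by \<open>SOME\<close> in \<open>tangent_map\<close> is immaterial on tangent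
  vectors.\<close>

lemma frechet_derivative_transition:
  assumes M: "smooth_manifold M" and c: "c \<in> charts_at M p" "d \<in> charts_at M p"
    and f: "(f \<circ> chart_inv d) differentiable (at (snd d p))"
  shows "frechet_derivative (f \<circ> chart_inv c) (at (snd c p)) u
       = frechet_derivative (f \<circ> chart_inv d) (at (snd d p))
           (frechet_derivative (transition c d) (at (snd c p)) u)"
    and "(f \<circ> chart_inv c) differentiable (at (snd c p))"
proof -
  have "openin (mtop M) (fst d)" "p \<in> fst d"
    using openin_chart_domain[OF M] charts_atD[OF c(2)] by auto
  from chart_nhd[OF M c(1) this]
  obtain N where N: "open N" "snd c p \<in> N" "\<And>y. y \<in> N \<Longrightarrow> chart_inv c y \<in> fst c \<inter> fst d"
    by metis
  have eq: "((f \<circ> chart_inv d) \<circ> transition c d) y = (f \<circ> chart_inv c) y" if "y \<in> N" for y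
    using chart_inv_snd[OF inj_on_chart[OF M charts_atD(1)[OF c(2)]]] N(3)[OF that]
    by (simp add: transition_def)
  have f': "(f \<circ> chart_inv d) differentiable (at (transition c d (snd c p)))"
    using f transition_at[OF M c(1), of d] by simp
  note t = transition_differentiable[OF M c]
  show "(f \<circ> chart_inv c) differentiable (at (snd c p))"
    by (rule differentiable_transform_open[OF differentiable_chain_at[OF t f'] N(1,2) eq])
  have "frechet_derivative (f \<circ> chart_inv c) (at (snd c p))
      = frechet_derivative ((f \<circ> chart_inv d) \<circ> transition c d) (at (snd c p))"
    by (rule frechet_derivative_cong_open[OF N(1,2) eq[symmetric]])
  also have "\<dots> = frechet_derivative (f \<circ> chart_inv d) (at (snd d p)) \<circ>
      frechet_derivative (transition c d) (at (snd c p))"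
    unfolding frechet_derivative_compose[OF t f'] transition_at[OF M c(1)] ..
  finally show "frechet_derivative (f \<circ> chart_inv c) (at (snd c p)) u
       = frechet_derivative (f \<circ> chart_inv d) (at (snd d p))
           (frechet_derivative (transition c d) (at (snd c p)) u)"
    by simp
qed

section \<open>The linear structure of tangent spaces\<close>

lemma tangent_spaceI:
  assumes "\<And>c d. c \<in> charts_at M p \<Longrightarrow> d \<in> charts_at M p \<Longrightarrow>
      v d = frechet_derivative (transition c d) (at (snd c p)) (v c)"
    and "\<And>c. c \<notin> charts_at M p \<Longrightarrow> v c = 0"
  shows "v \<in> tangent_space M p"
  unfolding tangent_space_def using assms by blast

lemma tangent_space_chart:
  assumes "v \<in> tangent_space M p" "c \<in> charts_at M p" "d \<in> charts_at M p"
  shows "v d = frechet_derivative (transition c d) (at (snd c p)) (v c)"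
  using assms unfolding tangent_space_def by blast

lemma tangent_space_outside: "v \<in> tangent_space M p \<Longrightarrow> c \<notin> charts_at M p \<Longrightarrow> v c = 0"
  unfolding tangent_space_def by blast

text \<open>The substance is the direction from right to left, the cocycle rule for derivatives of
  transition maps: passing from \<open>c\<close> to \<open>e\<close> directly or through
  \<open>d\<close> is the same. It lets vectors be built and compared through one chart.\<close>

lemma tangent_space_iff:
  assumes "smooth_manifold M" "c \<in> charts_at M p"
  shows "v \<in> tangent_space M p \<longleftrightarrow> v = coord_tvec M c p (v c)"
proof
  assume v: "v \<in> tangent_space M p"
  show "v = coord_tvec M c p (v c)"
  proof
    fix d
    show "v d = coord_tvec M c p (v c) d"
    proof (cases "d \<in> charts_at M p")
      case True
      then have "v d = frechet_derivative (transition c d) (at (snd c p)) (v c)"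
        using tangent_space_chart[OF v assms(2)] by simp
      with True show ?thesis
        by (simp add: coord_tvec_def)
    qed (use tangent_space_outside[OF v] in \<open>simp add: coord_tvec_def\<close>)
  qed
next
  assume v: "v = coord_tvec M c p (v c)"
  have v': "v d = frechet_derivative (transition c d) (at (snd c p)) (v c)" if "d \<in> charts_at M p" for d
    using that by (subst v) (simp add: coord_tvec_def)
  have "v e = frechet_derivative (transition d e) (at (snd d p)) (v d)"
    if d: "d \<in> charts_at M p" "e \<in> charts_at M p" for d e
    using frechet_derivative_transition(1)[OF assms d(1), of "snd e" "v c"]
      transition_differentiable[OF assms(1) d]
    by (simp add: v'[OF d(1)] v'[OF d(2)] transition_def)
  moreover have "v d = 0" if "d \<notin> charts_at M p" for d
    using that by (subst v) (simp add: coord_tvec_def)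
  ultimately show "v \<in> tangent_space M p"
    by (rule tangent_spaceI)
qed

lemma coord_tvec_self:
  "smooth_manifold M \<Longrightarrow> c \<in> charts_at M p \<Longrightarrow> coord_tvec M c p u c = u"
  by (simp add: coord_tvec_def transition_self_derivative)

lemma coord_tvec_tangent:
  "smooth_manifold M \<Longrightarrow> c \<in> charts_at M p \<Longrightarrow> coord_tvec M c p u \<in> tangent_space M p"
  by (simp add: tangent_space_iff coord_tvec_self)

lemma coord_tvec_add:
  "smooth_manifold M \<Longrightarrow> c \<in> charts_at M p \<Longrightarrow>
    coord_tvec M c p (u + u') = coord_tvec M c p u + coord_tvec M c p u'"
  by (auto simp: coord_tvec_def fun_eq_iff linear_add[OF linear_transition])

lemma coord_tvec_scale:
  "smooth_manifold M \<Longrightarrow> c \<in> charts_at M p \<Longrightarrow>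
    coord_tvec M c p (a *\<^sub>R u) = tscale a (coord_tvec M c p u)"
  by (auto simp: coord_tvec_def tscale_def fun_eq_iff linear_cmul[OF linear_transition])

lemma tangent_space_add:
  assumes M: "smooth_manifold M" and u: "u \<in> tangent_space M p" and v: "v \<in> tangent_space M p"
  shows "u + v \<in> tangent_space M p"
proof (rule tangent_spaceI)
  fix c d assume c: "c \<in> charts_at M p" "d \<in> charts_at M p"
  show "(u + v) d = frechet_derivative (transition c d) (at (snd c p)) ((u + v) c)"
    by (simp add: linear_add[OF linear_transition[OF M c]] tangent_space_chart[OF u c] tangent_space_chart[OF v c])
qed (simp add: tangent_space_outside[OF u] tangent_space_outside[OF v])

lemma tangent_space_scale:
  assumes M: "smooth_manifold M" and u: "u \<in> tangent_space M p"
  shows "tscale a u \<in> tangent_space M p"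
proof (rule tangent_spaceI)
  fix c d assume c: "c \<in> charts_at M p" "d \<in> charts_at M p"
  show "tscale a u d = frechet_derivative (transition c d) (at (snd c p)) (tscale a u c)"
    by (simp add: tscale_def linear_cmul[OF linear_transition[OF M c]] tangent_space_chart[OF u c])
qed (simp add: tscale_def tangent_space_outside[OF u])

text \<open>The axioms for the metric and the connection speak of sums and of \<open>tscale\<close>;
  all statements on differences are reduced to them here.\<close>

lemma diff_tvec: "u - v = u + tscale (-1) v"
  by (simp add: tscale_def fun_eq_iff)

lemma tangent_space_diff:
  "smooth_manifold M \<Longrightarrow> u \<in> tangent_space M p \<Longrightarrow> v \<in> tangent_space M p \<Longrightarrow>
    u - v \<in> tangent_space M p"
  by (simp add: diff_tvec tangent_space_add tangent_space_scale)

lemma tangent_space_zero: "smooth_manifold M \<Longrightarrow> 0 \<in> tangent_space M p"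
  by (rule tangent_spaceI) (simp_all add: linear_0[OF linear_transition])

section \<open>Tangent maps and the chain rule\<close>

text \<open>A pointwise notion, because a local section of the projection is meaningful only over
  part of the base and orbit maps are considered only at the identity. The first conjunct replaces
  continuity at \<open>p\<close>: it keeps images inside a chart domain, so that coordinate
  expressions can be composed.\<close>

definition differentiable_map_at ::
    "('m, 'e::real_normed_vector) manifold \<Rightarrow> ('n, 'f::real_normed_vector) manifold \<Rightarrow>
     ('m \<Rightarrow> 'n) \<Rightarrow> 'm \<Rightarrow> bool" where
  "differentiable_map_at M N f p \<longleftrightarrow>
     (\<forall>d\<in>charts_at N (f p). \<exists>W. openin (mtop M) W \<and> p \<in> W \<and> f ` W \<subseteq> fst d) \<and>
     (\<forall>c\<in>charts_at M p. \<forall>d\<in>charts_at N (f p). (snd d \<circ> f \<circ> chart_inv c) differentiable (at (snd c p)))"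

lemma differentiable_map_atD:
  "differentiable_map_at M N f p \<Longrightarrow> c \<in> charts_at M p \<Longrightarrow> d \<in> charts_at N (f p) \<Longrightarrow>
    (snd d \<circ> f \<circ> chart_inv c) differentiable (at (snd c p))"
  by (simp add: differentiable_map_at_def)

lemma smooth_map_differentiable_at:
  assumes M: "smooth_manifold M" and N: "smooth_manifold N" and f: "smooth_map M N f" and p: "p \<in> points M"
  shows "differentiable_map_at M N f p"
  unfolding differentiable_map_at_def
proof (intro conjI ballI)
  fix d assume d: "d \<in> charts_at N (f p)"
  have "openin (mtop M) {q \<in> points M. f q \<in> fst d}"
    using f openin_chart_domain[OF N charts_atD(1)[OF d]]
    by (auto simp: smooth_map_def intro: openin_continuous_map_preimage)
  then show "\<exists>W. openin (mtop M) W \<and> p \<in> W \<and> f ` W \<subseteq> fst d"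
    using p charts_atD(2)[OF d] by (intro exI[of _ "{q \<in> points M. f q \<in> fst d}"]) auto
  fix c assume c: "c \<in> charts_at M p"
  show "(snd d \<circ> f \<circ> chart_inv c) differentiable (at (snd c p))"
    using f charts_atD[OF c] charts_atD[OF d] unfolding smooth_map_def
    by (intro smooth_on_differentiable[of "snd c ` {p \<in> fst c. f p \<in> fst d}"]) auto
qed

lemma tangent_map_coord:
  assumes M: "smooth_manifold M" and f: "differentiable_map_at M N f p"
    and v: "v \<in> tangent_space M p" and c: "c \<in> charts_at M p" and d: "d \<in> charts_at N (f p)"
  shows "tangent_map M N f p v d = frechet_derivative (snd d \<circ> f \<circ> chart_inv c) (at (snd c p)) (v c)"
proof -
  define c0 where "c0 = (SOME c. c \<in> charts_at M p)"
  have c0: "c0 \<in> charts_at M p"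
    using some_chart_at[OF M charts_at_points[OF M c]] by (simp add: c0_def)
  have "v c = frechet_derivative (transition c0 c) (at (snd c0 p)) (v c0)"
    by (rule tangent_space_chart[OF v c0 c])
  then show ?thesis
    using frechet_derivative_transition(1)[OF M c0 c differentiable_map_atD[OF f c d]] d
    by (simp add: tangent_map_def Let_def c0_def)
qed

lemma tangent_map_tangent:
  assumes M: "smooth_manifold M" and N: "smooth_manifold N" and p: "p \<in> points M"
    and f: "differentiable_map_at M N f p"
  shows "tangent_map M N f p v \<in> tangent_space N (f p)"
proof -
  define c where "c = (SOME c. c \<in> charts_at M p)"
  have c: "c \<in> charts_at M p"
    using some_chart_at[OF M p] by (simp add: c_def)
  have T: "tangent_map M N f p v d = frechet_derivative (snd d \<circ> f \<circ> chart_inv c) (at (snd c p)) (v c)"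
    if "d \<in> charts_at N (f p)" for d
    using that by (simp add: tangent_map_def Let_def c_def)
  have "tangent_map M N f p v e
      = frechet_derivative (transition d e) (at (snd d (f p))) (tangent_map M N f p v d)"
    if d: "d \<in> charts_at N (f p)" and e: "e \<in> charts_at N (f p)" for d e
  proof -
    let ?g = "snd d \<circ> f \<circ> chart_inv c"
    obtain W where W: "openin (mtop M) W" "p \<in> W" "f ` W \<subseteq> fst d"
      using f d by (auto simp: differentiable_map_at_def)
    obtain O' where O': "open O'" "snd c p \<in> O'" "\<And>y. y \<in> O' \<Longrightarrow> chart_inv c y \<in> fst c \<inter> W"
      using chart_nhd[OF M c W(1,2)] by metis
    have gp: "?g (snd c p) = snd d (f p)"
      by (simp add: chart_inv_chart_at[OF M c])
    have "frechet_derivative (snd e \<circ> f \<circ> chart_inv c) (at (snd c p))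
        = frechet_derivative (transition d e \<circ> ?g) (at (snd c p))"
    proof (rule frechet_derivative_cong_open[OF O'(1,2)])
      fix y assume "y \<in> O'"
      then have "f (chart_inv c y) \<in> fst d"
        using O'(3) W(3) by blast
      then show "(snd e \<circ> f \<circ> chart_inv c) y = (transition d e \<circ> ?g) y"
        using chart_inv_snd[OF inj_on_chart[OF N charts_atD(1)[OF d]]] by (simp add: transition_def)
    qed
    also have "\<dots> = frechet_derivative (transition d e) (at (snd d (f p))) \<circ> frechet_derivative ?g (at (snd c p))"
      using frechet_derivative_compose[OF differentiable_map_atD[OF f c d], of "transition d e"]
        transition_differentiable[OF N d e] unfolding gp by simp
    finally show ?thesis
      by (simp add: T d e)
  qed
  then show ?thesis
    by (rule tangent_spaceI) (simp_all add: tangent_map_def Let_def)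
qed

lemma tangent_map_add:
  assumes "smooth_manifold M" "p \<in> points M" "differentiable_map_at M N f p"
  shows "tangent_map M N f p (u + v) = tangent_map M N f p u + tangent_map M N f p v"
  using linear_add[OF linear_frechet_derivative[OF differentiable_map_atD[OF assms(3) some_chart_at[OF assms(1,2)]]]]
  by (auto simp: tangent_map_def Let_def fun_eq_iff)

lemma tangent_map_scale:
  assumes "smooth_manifold M" "p \<in> points M" "differentiable_map_at M N f p"
  shows "tangent_map M N f p (tscale a v) = tscale a (tangent_map M N f p v)"
  using linear_cmul[OF linear_frechet_derivative[OF differentiable_map_atD[OF assms(3) some_chart_at[OF assms(1,2)]]]]
  by (auto simp: tangent_map_def Let_def tscale_def fun_eq_iff)

lemma tangent_map_diff:
  assumes "smooth_manifold M" "p \<in> points M" "differentiable_map_at M N f p"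
  shows "tangent_map M N f p (u - v) = tangent_map M N f p u - tangent_map M N f p v"
  by (simp add: diff_tvec tangent_map_add[OF assms] tangent_map_scale[OF assms])

text \<open>The outer map \<open>g\<close> takes values in a normed space, so that one chain rule
  serves both real functions and, with \<open>g\<close> followed by a chart, maps into a manifold.
  The factorization \<open>h = g o f\<close> is required only near \<open>p\<close>, as for a local
  section, whose projection is the identity only over its domain.\<close>

lemma frechet_derivative_chart_compose:
  assumes M: "smooth_manifold M" and N: "smooth_manifold N"
    and f: "differentiable_map_at M N f p" and c: "c \<in> charts_at M p" and d: "d \<in> charts_at N (f p)"
    and g: "(g \<circ> chart_inv d) differentiable (at (snd d (f p)))"
    and W: "openin (mtop M) W" "p \<in> W" and h: "\<And>q. q \<in> W \<Longrightarrow> h q = g (f q)"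
  shows "frechet_derivative (g \<circ> chart_inv d) (at (snd d (f p)))
           (frechet_derivative (snd d \<circ> f \<circ> chart_inv c) (at (snd c p)) u)
       = frechet_derivative (h \<circ> chart_inv c) (at (snd c p)) u"
proof -
  let ?f = "snd d \<circ> f \<circ> chart_inv c"
  obtain W' where W': "openin (mtop M) W'" "p \<in> W'" "f ` W' \<subseteq> fst d"
    using f d by (auto simp: differentiable_map_at_def)
  have "openin (mtop M) (W \<inter> W')" "p \<in> W \<inter> W'"
    using W W' by auto
  from chart_nhd[OF M c this]
  obtain O' where O': "open O'" "snd c p \<in> O'" "\<And>y. y \<in> O' \<Longrightarrow> chart_inv c y \<in> fst c \<inter> (W \<inter> W')"
    by metis
  have gp: "?f (snd c p) = snd d (f p)"
    by (simp add: chart_inv_chart_at[OF M c])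
  have "frechet_derivative (h \<circ> chart_inv c) (at (snd c p))
      = frechet_derivative ((g \<circ> chart_inv d) \<circ> ?f) (at (snd c p))"
  proof (rule frechet_derivative_cong_open[OF O'(1,2)])
    fix y assume y: "y \<in> O'"
    then have "f (chart_inv c y) \<in> fst d"
      using O'(3) W'(3) by blast
    then show "(h \<circ> chart_inv c) y = ((g \<circ> chart_inv d) \<circ> ?f) y"
      using chart_inv_snd[OF inj_on_chart[OF N charts_atD(1)[OF d]]] O'(3)[OF y] h by simp
  qed
  also have "\<dots> = frechet_derivative (g \<circ> chart_inv d) (at (snd d (f p))) \<circ> frechet_derivative ?f (at (snd c p))"
    using frechet_derivative_compose[OF differentiable_map_atD[OF f c d], of "g \<circ> chart_inv d"] g
    unfolding gp by simp
  finally show ?thesis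
    by simp
qed

lemma tangent_map_compose:
  assumes M: "smooth_manifold M" and N: "smooth_manifold N" and p: "p \<in> points M" "f p \<in> points N"
    and f: "differentiable_map_at M N f p" and g: "differentiable_map_at N P g (f p)"
    and W: "openin (mtop M) W" "p \<in> W" and h: "\<And>q. q \<in> W \<Longrightarrow> h q = g (f q)"
  shows "tangent_map N P g (f p) (tangent_map M N f p v) = tangent_map M P h p v"
proof
  fix e
  show "tangent_map N P g (f p) (tangent_map M N f p v) e = tangent_map M P h p v e"
  proof (cases "e \<in> charts_at P (h p)")
    case True
    then have e: "e \<in> charts_at P (g (f p))"
      using h W(2) by simp
    note c = some_chart_at[OF M p(1)] and d = some_chart_at[OF N p(2)]
    have "(snd e \<circ> h) q = (snd e \<circ> g) (f q)" if "q \<in> W" for q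
      using h[OF that] by simp
    note * = frechet_derivative_chart_compose[OF M N f c d differentiable_map_atD[OF g d e] W this]
    show ?thesis
      unfolding tangent_map_def Let_def if_P[OF True] if_P[OF d] if_P[OF e] by (rule *)
  qed (simp add: tangent_map_def Let_def h W)
qed

lemma tangent_map_const:
  fixes M :: "('m, 'e::fin_dim_inner) manifold" and P :: "('n, 'b::real_normed_vector) manifold"
  assumes M: "smooth_manifold M" and p: "p \<in> points M"
    and W: "openin (mtop M) W" "p \<in> W" and h: "\<And>q. q \<in> W \<Longrightarrow> h q = z"
  shows "tangent_map M P h p v = 0"
proof
  fix e :: "('n, 'b) chart"
  let ?c = "SOME c. c \<in> charts_at M p"
  obtain O' where O': "open O'" "snd ?c p \<in> O'" "\<And>y. y \<in> O' \<Longrightarrow> chart_inv ?c y \<in> fst ?c \<inter> W"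
    using chart_nhd[OF M some_chart_at[OF M p] W] by metis
  have "frechet_derivative (snd e \<circ> h \<circ> chart_inv ?c) (at (snd ?c p))
      = frechet_derivative (\<lambda>y. snd e z) (at (snd ?c p))"
    by (rule frechet_derivative_cong_open[OF O'(1,2)]) (use O'(3) h in auto)
  then show "tangent_map M P h p v e = 0 e"
    by (simp add: tangent_map_def Let_def)
qed

lemma tangent_map_ident:
  fixes M :: "('a, 'b::fin_dim_inner) manifold"
  assumes M: "smooth_manifold M" and p: "p \<in> points M" and v: "v \<in> tangent_space M p"
  shows "tangent_map M M (\<lambda>q. q) p v = v"
proof
  fix e
  have "f \<circ> (\<lambda>q. q) = f" for f :: "'a \<Rightarrow> 'b"
    by (simp add: o_def)
  then show "tangent_map M M (\<lambda>q. q) p v e = v e"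
    using tangent_space_chart[OF v some_chart_at[OF M p], of e] tangent_space_outside[OF v, of e]
    by (cases "e \<in> charts_at M p") (simp_all add: tangent_map_def Let_def transition_def)
qed

lemma dir_deriv_zero:
  assumes M: "smooth_manifold M" and p: "p \<in> points M"
    and W: "openin (mtop M) W" "p \<in> W" and h: "\<And>q. q \<in> W \<Longrightarrow> h q = z"
  shows "dir_deriv M v h p = 0"
proof -
  let ?c = "SOME c. c \<in> charts_at M p"
  obtain O' where O': "open O'" "snd ?c p \<in> O'" "\<And>y. y \<in> O' \<Longrightarrow> chart_inv ?c y \<in> fst ?c \<inter> W"
    using chart_nhd[OF M some_chart_at[OF M p] W] by metis
  have "frechet_derivative (h \<circ> chart_inv ?c) (at (snd ?c p)) = frechet_derivative (\<lambda>y. z) (at (snd ?c p))"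
    by (rule frechet_derivative_cong_open[OF O'(1,2)]) (use O'(3) h in auto)
  then show ?thesis
    by (simp add: dir_deriv_def Let_def)
qed

lemma dir_deriv_tangent_map:
  assumes M: "smooth_manifold M" and N: "smooth_manifold N" and p: "p \<in> points M" "f p \<in> points N"
    and f: "differentiable_map_at M N f p"
    and g: "\<And>d. d \<in> charts_at N (f p) \<Longrightarrow> (g \<circ> chart_inv d) differentiable (at (snd d (f p)))"
    and W: "openin (mtop M) W" "p \<in> W" and h: "\<And>q. q \<in> W \<Longrightarrow> h q = g (f q)"
  shows "dir_deriv N (tangent_map M N f p v) g (f p) = dir_deriv M v h p"
  using frechet_derivative_chart_compose[OF M N f some_chart_at[OF M p(1)] some_chart_at[OF N p(2)] g W h]
    some_chart_at[OF N p(2)]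
  by (simp add: dir_deriv_def tangent_map_def Let_def)

section \<open>Vector fields and brackets of related fields\<close>

lemma vector_field_tangent: "vector_field M X \<Longrightarrow> p \<in> points M \<Longrightarrow> X p \<in> tangent_space M p"
  by (simp add: vector_field_def)

lemma coord_field_differentiable:
  assumes "vector_field M X" "c \<in> charts_at M p"
  shows "coord_field X c differentiable (at (snd c p))"
  by (rule smooth_on_differentiable[of "snd c ` fst c"])
    (use assms charts_atD[OF assms(2)] in \<open>simp_all add: vector_field_def\<close>)

lemma coord_field_at:
  "smooth_manifold M \<Longrightarrow> c \<in> charts_at M p \<Longrightarrow> coord_field X c (snd c p) = X p c"
  by (simp add: coord_field_def chart_inv_chart_at)

text \<open>In charts the fields are related by \<open>F = snd d o f o chart_inv c\<close> on the
  open set \<open>S\<close> of coordinates whose points \<open>f\<close> sends into the domain of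
  \<open>d\<close>, and there \<open>related_bracket_coord\<close> applies.\<close>

lemma lie_bracket_related:
  fixes Q :: "('n, 'b::fin_dim_inner) manifold" and M :: "('m, 'e::fin_dim_inner) manifold"
  assumes M: "smooth_manifold M" and Q: "smooth_manifold Q" and f: "smooth_map M Q f"
    and X: "vector_field M X" and Y: "vector_field M Y"
    and X1: "vector_field Q X1" and Y1: "vector_field Q Y1"
    and rX: "\<And>q. q \<in> points M \<Longrightarrow> tangent_map M Q f q (X q) = X1 (f q)"
    and rY: "\<And>q. q \<in> points M \<Longrightarrow> tangent_map M Q f q (Y q) = Y1 (f q)"
    and p: "p \<in> points M"
  shows "tangent_map M Q f p (lie_bracket M X Y p) = lie_bracket Q X1 Y1 (f p)"
proof
  fix d
  define c where "c = (SOME c. c \<in> charts_at M p)"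
  have c: "c \<in> charts_at M p"
    using some_chart_at[OF M p] by (simp add: c_def)
  show "tangent_map M Q f p (lie_bracket M X Y p) d = lie_bracket Q X1 Y1 (f p) d"
  proof (cases "d \<in> charts_at Q (f p)")
    case d: True
    define W where "W = {q \<in> points M. f q \<in> fst d}"
    define S where "S = snd c ` (fst c \<inter> W)"
    define F where "F = snd d \<circ> f \<circ> chart_inv c"
    have W: "openin (mtop M) W"
      using f openin_chart_domain[OF Q charts_atD(1)[OF d]]
      by (auto simp: smooth_map_def W_def intro: openin_continuous_map_preimage)
    have S: "open S" "snd c p \<in> S"
      using open_chart_image[OF M charts_atD(1)[OF c] W] charts_atD[OF c] charts_atD[OF d] p
      by (auto simp: S_def W_def)
    have "fst c \<inter> W = {q \<in> fst c. f q \<in> fst d}"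
      using chart_domain_subset[OF M charts_atD(1)[OF c]] by (auto simp: W_def)
    then have F: "smooth_on S F"
      using f charts_atD[OF c] charts_atD[OF d] by (simp add: smooth_map_def S_def F_def)
    have Fp: "F (snd c p) = snd d (f p)"
      by (simp add: F_def chart_inv_chart_at[OF M c])
    have r: "frechet_derivative F (at y) (coord_field Z c y) = coord_field Z1 d (F y)"
      if y: "y \<in> S" and Z: "vector_field M Z"
        and rZ: "\<And>q. q \<in> points M \<Longrightarrow> tangent_map M Q f q (Z q) = Z1 (f q)" for y Z Z1
    proof -
      obtain q where q: "y = snd c q" "q \<in> fst c" "q \<in> points M" "f q \<in> fst d"
        using y by (auto simp: S_def W_def)
      have cq: "c \<in> charts_at M q" and dq: "d \<in> charts_at Q (f q)"
        using q charts_atD[OF c] charts_atD[OF d] by (simp_all add: charts_at_def)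
      have "frechet_derivative F (at y) (coord_field Z c y) = tangent_map M Q f q (Z q) d"
        using tangent_map_coord[OF M smooth_map_differentiable_at[OF M Q f q(3)]
            vector_field_tangent[OF Z q(3)] cq dq]
        by (simp add: F_def q(1) coord_field_at[OF M cq])
      also have "\<dots> = coord_field Z1 d (F y)"
        by (simp add: rZ q F_def coord_field_def chart_inv_chart_at[OF M cq] chart_inv_chart_at[OF Q dq])
      finally show ?thesis .
    qed
    show ?thesis
      using related_bracket_coord[OF F S coord_field_differentiable[OF X c] coord_field_differentiable[OF Y c]
          _ _ r[OF _ X rX] r[OF _ Y rY]]
        coord_field_differentiable[OF X1 d] coord_field_differentiable[OF Y1 d]
      by (simp add: tangent_map_def lie_bracket_def c_def[symmetric] c d F_def[symmetric] Fp
          coord_field_at[OF M c] coord_field_at[OF Q d])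
  qed (simp add: tangent_map_def lie_bracket_def)
qed

section \<open>The mechanical connection\<close>

text \<open>Freezing the second variable is composition with the affine map
  \<open>y |-> (y, snd c2 q)\<close> in a product chart. It yields the orbit maps from the action,
  and local sections from trivializations.\<close>

lemma differentiable_partial_map:
  fixes c1 :: "('m, 'e::real_normed_vector) chart" and c2 :: "('n, 'f::real_normed_vector) chart"
    and F :: "'m \<times> 'n \<Rightarrow> 'p" and f :: "'p \<Rightarrow> 'b::real_normed_vector"
  assumes inj: "inj_on (snd c1) (fst c1)" "inj_on (snd c2) (fst c2)"
    and o: "open (snd c1 ` fst c1)" and p: "p \<in> fst c1" "q \<in> fst c2"
    and F: "(f \<circ> F \<circ> chart_inv (fst c1 \<times> fst c2, map_prod (snd c1) (snd c2)))
              differentiable (at (snd c1 p, snd c2 q))"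
  shows "(f \<circ> (\<lambda>p. F (p, q)) \<circ> chart_inv c1) differentiable (at (snd c1 p))"
proof -
  let ?c = "(fst c1 \<times> fst c2, map_prod (snd c1) (snd c2))"
  have inv: "chart_inv ?c (snd c1 p', snd c2 q) = (p', q)" if "p' \<in> fst c1" for p'
    using chart_inv_snd[of ?c "(p', q)"] map_prod_inj_on[OF inj] that p by simp
  have "(\<lambda>y. (y, snd c2 q)) differentiable (at (snd c1 p))"
    by (intro derivative_intros)
  from differentiable_chain_at[OF this F]
  show ?thesis
  proof (rule differentiable_transform_open[OF _ o])
    show "snd c1 p \<in> snd c1 ` fst c1"
      using p by simp
    fix y assume "y \<in> snd c1 ` fst c1"
    then obtain p' where p': "p' \<in> fst c1" "y = snd c1 p'"
      by blast
    show "(f \<circ> F \<circ> chart_inv ?c \<circ> (\<lambda>y. (y, snd c2 q))) y = (f \<circ> (\<lambda>p. F (p, q)) \<circ> chart_inv c1) y"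
      by (simp add: p'(2) inv[OF p'(1)] chart_inv_snd[OF inj(1) p'(1)])
  qed
qed

lemma prod_manifold_atlas:
  assumes "c \<in> atlas M" "d \<in> atlas N"
  shows "(fst c \<times> fst d, map_prod (snd c) (snd d)) \<in> atlas (prod_manifold M N)"
  unfolding prod_manifold_def manifold.select_convs using assms by blast

lemma open_submanifold_atlas:
  assumes "c \<in> atlas M"
  shows "(fst c \<inter> W, snd c) \<in> atlas (open_submanifold M W)"
  unfolding open_submanifold_def manifold.select_convs using assms by blast

text \<open>The zero field on the base is the one to which vertical fields are related.\<close>

lemma vector_field_zero: "smooth_manifold M \<Longrightarrow> vector_field M (\<lambda>p. 0)"
  by (simp add: vector_field_def tangent_space_zero coord_field_def smooth_on_const)

lemma lie_bracket_zero_right: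
  assumes M: "smooth_manifold M" and X: "vector_field M X"
  shows "lie_bracket M X (\<lambda>p. 0) p = 0"
proof
  fix c
  show "lie_bracket M X (\<lambda>p. 0) p c = 0 c"
    using linear_0[OF linear_frechet_derivative[OF coord_field_differentiable[OF X]], of c p]
    by (simp add: lie_bracket_def coord_field_def[of "\<lambda>p. 0"])
qed

section \<open>The bundle data and the pointwise algebra of \<open>k\<close> and
  \<open>A\<close>\<close>

locale mechanical_bundle =
  fixes M :: "('m, 'e::fin_dim_inner) manifold"
    and G :: "('g, 'f::fin_dim_inner) lie_grp"
    and Q :: "('m set, 'b::fin_dim_inner) manifold"
    and \<phi> :: "'g \<Rightarrow> 'm \<Rightarrow> 'm"
    and k :: "'m \<Rightarrow> ('m, 'e) tvec \<Rightarrow> ('m, 'e) tvec \<Rightarrow> real"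
    and nabla :: "('m \<Rightarrow> ('m, 'e) tvec) \<Rightarrow> ('m \<Rightarrow> ('m, 'e) tvec) \<Rightarrow> 'm \<Rightarrow> ('m, 'e) tvec"
    and A :: "'m \<Rightarrow> ('m, 'e) tvec \<Rightarrow> ('g, 'f) tvec"
  assumes M: "smooth_manifold M" and metric: "riemannian_metric M k"
    and lie_group: "lie_group G" and action: "smooth_action G M \<phi>"
    and principal: "principal_bundle G M Q \<phi>"
    and mechanical: "mechanical_connection G M Q \<phi> k A"
    and levi_civita: "levi_civita M k nabla"
begin

abbreviation "proj \<equiv> orbit G \<phi>"
abbreviation "dproj \<equiv> tangent_map M Q proj"
abbreviation "generator \<equiv> inf_generator G M \<phi>"
abbreviation "horizontal \<equiv> horizontal_space M A"
abbreviation "vertical \<equiv> vertical_space G M Q \<phi>"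

lemma metric_sym:
  "p \<in> points M \<Longrightarrow> u \<in> tangent_space M p \<Longrightarrow> v \<in> tangent_space M p \<Longrightarrow> k p u v = k p v u"
  using metric unfolding riemannian_metric_def by blast

lemma metric_add_left:
  "p \<in> points M \<Longrightarrow> u \<in> tangent_space M p \<Longrightarrow> v \<in> tangent_space M p \<Longrightarrow> w \<in> tangent_space M p \<Longrightarrow>
    k p (u + v) w = k p u w + k p v w"
  using metric unfolding riemannian_metric_def by blast

lemma metric_scale_left:
  "p \<in> points M \<Longrightarrow> u \<in> tangent_space M p \<Longrightarrow> v \<in> tangent_space M p \<Longrightarrow>
    k p (tscale a u) v = a * k p u v"
  using metric unfolding riemannian_metric_def by blast

lemma metric_diff_left:
  "p \<in> points M \<Longrightarrow> u \<in> tangent_space M p \<Longrightarrow> v \<in> tangent_space M p \<Longrightarrow> w \<in> tangent_space M p \<Longrightarrow>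
    k p (u - v) w = k p u w - k p v w"
  by (simp add: diff_tvec metric_add_left metric_scale_left tangent_space_scale[OF M])

lemma metric_definite:
  assumes "p \<in> points M" "u \<in> tangent_space M p" "k p u u = 0"
  shows "u = 0"
proof (rule ccontr)
  assume "u \<noteq> 0"
  then have "k p u u > 0"
    using metric assms(1,2) unfolding riemannian_metric_def by blast
  with assms(3) show False
    by simp
qed

lemma connection: "principal_connection G M \<phi> A"
  using mechanical by (simp add: mechanical_connection_def)

lemma connection_in_lie_algebra:
  "p \<in> points M \<Longrightarrow> u \<in> tangent_space M p \<Longrightarrow> A p u \<in> lie_algebra G"
  using connection unfolding principal_connection_def by blast

lemma connection_add:
  "p \<in> points M \<Longrightarrow> u \<in> tangent_space M p \<Longrightarrow> v \<in> tangent_space M p \<Longrightarrow> A p (u + v) = A p u + A p v"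
  using connection unfolding principal_connection_def by blast

lemma connection_scale:
  "p \<in> points M \<Longrightarrow> u \<in> tangent_space M p \<Longrightarrow> A p (tscale a u) = tscale a (A p u)"
  using connection unfolding principal_connection_def by blast

lemma connection_diff:
  "p \<in> points M \<Longrightarrow> u \<in> tangent_space M p \<Longrightarrow> v \<in> tangent_space M p \<Longrightarrow> A p (u - v) = A p u - A p v"
  by (simp add: diff_tvec connection_add connection_scale tangent_space_scale[OF M])

lemma connection_generator:
  "p \<in> points M \<Longrightarrow> \<xi> \<in> lie_algebra G \<Longrightarrow> A p (generator \<xi> p) = \<xi>"
  using connection unfolding principal_connection_def by blast

lemma horizontal_iff_orthogonal:
  "p \<in> points M \<Longrightarrow>
    v \<in> horizontal p \<longleftrightarrow> v \<in> tangent_space M p \<and> (\<forall>w\<in>vertical p. k p v w = 0)"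
  using mechanical unfolding mechanical_connection_def by blast

lemma metric_horizontal_vertical:
  "p \<in> points M \<Longrightarrow> u \<in> horizontal p \<Longrightarrow> v \<in> vertical p \<Longrightarrow> k p u v = 0"
  using horizontal_iff_orthogonal by blast

text \<open>Such a vector is orthogonal to itself. This is the source of the uniqueness of
  horizontal lifts.\<close>

lemma horizontal_vertical_zero:
  assumes "p \<in> points M" "u \<in> horizontal p" "u \<in> vertical p"
  shows "u = 0"
  using assms metric_horizontal_vertical[OF assms] by (intro metric_definite) (auto simp: horizontal_space_def)

section \<open>The action, the projection and the infinitesimal generators\<close>

lemma
  shows group: "group G" and gmfd: "smooth_manifold (gmfd G)" and gpoints: "points (gmfd G) = carrier G"
  using lie_group by (simp_all add: lie_group_def)

lemma
  shows Q: "smooth_manifold Q" and Q_points: "points Q = orbits G (points M) \<phi>"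
    and proj_smooth: "smooth_map M Q proj"
  using principal by (simp_all add: principal_bundle_def)

lemma group_action: "group_action G (points M) \<phi>"
  using action by (simp add: smooth_action_def)

lemma one_closed: "\<one>\<^bsub>G\<^esub> \<in> carrier G"
  using group by (simp add: group.is_monoid monoid.one_closed)

lemma action_one: "p \<in> points M \<Longrightarrow> \<phi> \<one>\<^bsub>G\<^esub> p = p"
  using group_action.id_eq_one[OF group_action] by (metis restrict_apply')

lemma proj_action:
  assumes g: "g \<in> carrier G" and p: "p \<in> points M"
  shows "proj (\<phi> g p) = proj p"
proof
  interpret group G by (rule group)
  note comp = group_action.composition_rule[OF group_action]
  show "proj (\<phi> g p) \<subseteq> proj p"
  proof
    fix z assume "z \<in> proj (\<phi> g p)"
    then obtain h where h: "h \<in> carrier G" "z = \<phi> h (\<phi> g p)"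
      by (auto simp: orbit_def)
    then have "h \<otimes>\<^bsub>G\<^esub> g \<in> carrier G" "z = \<phi> (h \<otimes>\<^bsub>G\<^esub> g) p"
      using comp[OF p h(1) g] g by auto
    then show "z \<in> proj p"
      unfolding orbit_def by blast
  qed
  have "\<phi> h p = \<phi> (h \<otimes>\<^bsub>G\<^esub> inv\<^bsub>G\<^esub> g) (\<phi> g p)" if h: "h \<in> carrier G" for h
    using comp[OF p _ g, of "h \<otimes>\<^bsub>G\<^esub> inv\<^bsub>G\<^esub> g"] g h by (simp add: m_assoc)
  moreover have "h \<otimes>\<^bsub>G\<^esub> inv\<^bsub>G\<^esub> g \<in> carrier G" if "h \<in> carrier G" for h
    using g that by simp
  ultimately show "proj p \<subseteq> proj (\<phi> g p)"
    unfolding orbit_def by blast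
qed

lemma proj_points: "p \<in> points M \<Longrightarrow> proj p \<in> points Q"
  unfolding Q_points orbits_def by blast

lemma proj_differentiable: "p \<in> points M \<Longrightarrow> differentiable_map_at M Q proj p"
  by (rule smooth_map_differentiable_at[OF M Q proj_smooth])

text \<open>The orbit map is the slice of the smooth action at the fixed point \<open>p\<close>,
  read in the product of a chart of \<open>G\<close> with an arbitrary chart around
  \<open>p\<close>. The identity is the point at which generators are formed.\<close>

lemma orbit_map_differentiable:
  assumes p: "p \<in> points M"
  shows "differentiable_map_at (gmfd G) M (\<lambda>g. \<phi> g p) \<one>\<^bsub>G\<^esub>"
proof -
  let ?F = "\<lambda>(g, x). \<phi> g x"
  have F: "smooth_map (prod_manifold (gmfd G) M) M ?F"
    using action by (simp add: smooth_action_def)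
  have "continuous_map (mtop (gmfd G)) (prod_topology (mtop (gmfd G)) (mtop M)) (\<lambda>g. (g, p))"
    using p by (intro continuous_map_pairedI) simp_all
  then have cont: "continuous_map (mtop (gmfd G)) (mtop M) (\<lambda>g. \<phi> g p)"
    using continuous_map_compose[of _ _ "\<lambda>g. (g, p)" _ ?F] F
    by (simp add: smooth_map_def prod_manifold_def o_def)
  show ?thesis
    unfolding differentiable_map_at_def
  proof (intro conjI ballI)
    fix d assume d: "d \<in> charts_at M (\<phi> \<one>\<^bsub>G\<^esub> p)"
    have "openin (mtop (gmfd G)) {g \<in> points (gmfd G). \<phi> g p \<in> fst d}"
      by (rule openin_continuous_map_preimage[OF cont openin_chart_domain[OF M charts_atD(1)[OF d]]])
    then show "\<exists>W. openin (mtop (gmfd G)) W \<and> \<one>\<^bsub>G\<^esub> \<in> W \<and> (\<lambda>g. \<phi> g p) ` W \<subseteq> fst d"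
      using charts_atD(2)[OF d] one_closed
      by (intro exI[of _ "{g \<in> points (gmfd G). \<phi> g p \<in> fst d}"]) (auto simp: gpoints)
    fix c assume c: "c \<in> charts_at (gmfd G) \<one>\<^bsub>G\<^esub>"
    obtain c2 where c2: "c2 \<in> charts_at M p"
      using charts_at_nonempty[OF M p] by blast
    let ?c = "(fst c \<times> fst c2, map_prod (snd c) (snd c2))"
    have "?c \<in> atlas (prod_manifold (gmfd G) M)"
      by (rule prod_manifold_atlas[OF charts_atD(1)[OF c] charts_atD(1)[OF c2]])
    then have "smooth_on (snd ?c ` {z \<in> fst ?c. ?F z \<in> fst d}) (snd d \<circ> ?F \<circ> chart_inv ?c)"
      using F charts_atD(1)[OF d] unfolding smooth_map_def by blast
    then have "(snd d \<circ> ?F \<circ> chart_inv ?c) differentiable (at (snd c \<one>\<^bsub>G\<^esub>, snd c2 p))"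
      by (rule smooth_on_differentiable)
        (use charts_atD(2)[OF c] charts_atD(2)[OF c2] charts_atD(2)[OF d] in force)
    then have "(snd d \<circ> (\<lambda>g. ?F (g, p)) \<circ> chart_inv c) differentiable (at (snd c \<one>\<^bsub>G\<^esub>))"
      using open_chart_image[OF gmfd charts_atD(1)[OF c] openin_chart_domain[OF gmfd charts_atD(1)[OF c]]]
      by (intro differentiable_partial_map[where ?c2.0 = c2] inj_on_chart[OF gmfd] inj_on_chart[OF M]
          charts_atD(1)[OF c] charts_atD(1)[OF c2] charts_atD(2)[OF c] charts_atD(2)[OF c2]) simp_all
    then show "(snd d \<circ> (\<lambda>g. \<phi> g p) \<circ> chart_inv c) differentiable (at (snd c \<one>\<^bsub>G\<^esub>))"
      by simp
  qed
qed

lemma generator_tangent: "p \<in> points M \<Longrightarrow> generator \<xi> p \<in> tangent_space M p"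
  using tangent_map_tangent[OF gmfd M _ orbit_map_differentiable, of p] one_closed
  by (simp add: inf_generator_def gpoints action_one)

lemma generator_scale: "p \<in> points M \<Longrightarrow> generator (tscale a \<xi>) p = tscale a (generator \<xi> p)"
  using tangent_map_scale[OF gmfd _ orbit_map_differentiable] one_closed
  by (simp add: inf_generator_def gpoints)

lemma generator_zero: "p \<in> points M \<Longrightarrow> generator 0 p = 0"
  using generator_scale[of p 0 0] by (simp add: tscale_def zero_fun_def)

text \<open>The projection is constant along the orbit, so its composite with the orbit map is
  constant and the chain rule gives 0.\<close>

lemma dproj_generator:
  assumes p: "p \<in> points M"
  shows "dproj p (generator \<xi> p) = 0"
proof -
  have one: "\<one>\<^bsub>G\<^esub> \<in> points (gmfd G)"
    using one_closed gpoints by simp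
  have "dproj (\<phi> \<one>\<^bsub>G\<^esub> p) (generator \<xi> p) = tangent_map (gmfd G) Q (\<lambda>g. proj p) \<one>\<^bsub>G\<^esub> \<xi>"
    unfolding inf_generator_def
  proof (rule tangent_map_compose[OF gmfd M one _ orbit_map_differentiable[OF p] _ openin_topspace one])
    show "differentiable_map_at M Q proj (\<phi> \<one>\<^bsub>G\<^esub> p)"
      using p proj_differentiable by (simp add: action_one)
  qed (use p in \<open>simp_all add: action_one proj_action gpoints\<close>)
  also have "\<dots> = 0"
    by (rule tangent_map_const[OF gmfd one openin_topspace one refl])
  finally show ?thesis
    using p by (simp add: action_one)
qed

text \<open>Since \<open>A\<close> reproduces generators, subtracting the generator of
  \<open>A p v\<close> makes the value of \<open>A\<close> vanish; since generators project to 0,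
  the projection is unaffected.\<close>

lemma horizontal_part:
  assumes p: "p \<in> points M" and v: "v \<in> tangent_space M p"
  shows "v - generator (A p v) p \<in> horizontal p" "dproj p (v - generator (A p v) p) = dproj p v"
  using p v
  by (simp_all add: horizontal_space_def tangent_space_diff[OF M] generator_tangent connection_diff
      connection_generator connection_in_lie_algebra tangent_map_diff[OF M p proj_differentiable] dproj_generator)

text \<open>A trivialization \<open>\<Phi>\<close> over a neighbourhood of \<open>proj p\<close> has
  a constant section \<open>u |-> \<Phi> (u, h)\<close> through \<open>p\<close>, whose differential
  is a right inverse of the differential of the projection.\<close>

lemma dproj_surjective:
  assumes p: "p \<in> points M" and w: "w \<in> tangent_space Q (proj p)"
  obtains v where "v \<in> tangent_space M p" "dproj p v = w"
proof -
  let ?b = "proj p"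
  have "\<forall>b\<in>points Q. \<exists>U \<Phi>. openin (mtop Q) U \<and> b \<in> U \<and>
        diffeomorphism (prod_manifold (open_submanifold Q U) (gmfd G))
          (open_submanifold M {x \<in> points M. proj x \<in> U}) \<Phi> \<and>
        (\<forall>u\<in>U. \<forall>h\<in>carrier G. proj (\<Phi> (u, h)) = u \<and>
           (\<forall>g\<in>carrier G. \<phi> g (\<Phi> (u, h)) = \<Phi> (u, g \<otimes>\<^bsub>G\<^esub> h)))"
    using principal unfolding principal_bundle_def by (elim conjE)
  from bspec[OF this proj_points[OF p]]
  obtain U \<Phi> where U: "openin (mtop Q) U" "?b \<in> U"
    and diffeo: "diffeomorphism (prod_manifold (open_submanifold Q U) (gmfd G))
          (open_submanifold M {x \<in> points M. proj x \<in> U}) \<Phi>"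
    and fib: "\<And>u h. u \<in> U \<Longrightarrow> h \<in> carrier G \<Longrightarrow> proj (\<Phi> (u, h)) = u"
    by (elim exE conjE) (rule that, assumption+, blast)
  define W where "W = {x \<in> points M. proj x \<in> U}"
  let ?P = "prod_manifold (open_submanifold Q U) (gmfd G)"
  have \<Phi>: "smooth_map ?P (open_submanifold M W) \<Phi>"
    using diffeo by (simp add: diffeomorphism_def W_def)
  have P_points: "points ?P = U \<times> carrier G"
    using openin_subset[OF U(1)] by (simp add: prod_manifold_def open_submanifold_def gpoints Int_absorb1)
  have W_points: "points (open_submanifold M W) = W"
    by (auto simp: open_submanifold_def W_def)
  have pW: "p \<in> W"
    using p U(2) by (simp add: W_def)
  obtain z where z: "z \<in> points ?P" "\<Phi> z = p"
  proof -
    obtain g where g: "smooth_map (open_submanifold M W) ?P g" "\<forall>q\<in>points (open_submanifold M W). \<Phi> (g q) = q"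
      using diffeo unfolding diffeomorphism_def W_def by blast
    have "g p \<in> points ?P"
      using g(1) pW continuous_map_image_subset_topspace[of "mtop (open_submanifold M W)" "mtop ?P" g]
      unfolding smooth_map_def W_points by blast
    then show ?thesis
      using that g(2) pW by (simp add: W_points)
  qed
  \<comment> \<open>The base component of any preimage of \<open>p\<close> under
    \<open>\<Phi>\<close> is forced to be \<open>proj p\<close>, because \<open>\<Phi>\<close>
    covers the identity of \<open>U\<close>.\<close>
  obtain h where h: "h \<in> carrier G" "\<Phi> (?b, h) = p"
  proof -
    obtain u h where uh: "z = (u, h)" "u \<in> U" "h \<in> carrier G"
      using z(1) P_points by auto
    then show ?thesis
      using that[of h] fib[of u h] z(2) by simp
  qed
  define s where "s u = \<Phi> (u, h)" for u
  have sb: "s ?b = p"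
    by (simp add: s_def h)
  have "continuous_map (subtopology (mtop Q) U) (prod_topology (subtopology (mtop Q) U) (mtop (gmfd G))) (\<lambda>u. (u, h))"
    using h(1) gpoints by (intro continuous_map_pairedI) simp_all
  from continuous_map_compose[OF this, of "subtopology (mtop M) W" \<Phi>]
  have cont: "continuous_map (subtopology (mtop Q) U) (mtop M) s"
    using \<Phi> by (simp add: smooth_map_def prod_manifold_def open_submanifold_def o_def s_def[abs_def]
        continuous_map_in_subtopology)
  have s: "differentiable_map_at Q M s ?b"
    unfolding differentiable_map_at_def
  proof (intro conjI ballI)
    fix d assume "d \<in> charts_at M (s ?b)"
    then have d: "d \<in> charts_at M p"
      by (simp add: sb)
    let ?W = "{u \<in> topspace (subtopology (mtop Q) U). s u \<in> fst d}"
    have "openin (subtopology (mtop Q) U) ?W"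
      by (rule openin_continuous_map_preimage[OF cont openin_chart_domain[OF M charts_atD(1)[OF d]]])
    then have "openin (mtop Q) ?W"
      using U(1) openin_trans_full by blast
    then show "\<exists>W. openin (mtop Q) W \<and> ?b \<in> W \<and> s ` W \<subseteq> fst d"
      using charts_atD(2)[OF d] U(2) proj_points[OF p] by (intro exI[of _ ?W]) (auto simp: sb)
    fix c assume c: "c \<in> charts_at Q ?b"
    obtain c2 where c2: "c2 \<in> charts_at (gmfd G) h"
      using charts_at_nonempty[OF gmfd] h(1) gpoints by blast
    let ?c1 = "(fst c \<inter> U, snd c)" and ?d = "(fst d \<inter> W, snd d)"
    let ?c = "(fst ?c1 \<times> fst c2, map_prod (snd ?c1) (snd c2))"
    have "?d \<in> atlas (open_submanifold M W)"
      by (rule open_submanifold_atlas[OF charts_atD(1)[OF d]])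
    moreover have "?c \<in> atlas ?P"
      by (rule prod_manifold_atlas[OF open_submanifold_atlas[OF charts_atD(1)[OF c]] charts_atD(1)[OF c2]])
    ultimately have "smooth_on (snd ?c ` {z \<in> fst ?c. \<Phi> z \<in> fst ?d}) (snd ?d \<circ> \<Phi> \<circ> chart_inv ?c)"
      using \<Phi> unfolding smooth_map_def by blast
    then have "(snd ?d \<circ> \<Phi> \<circ> chart_inv ?c) differentiable (at (snd ?c1 ?b, snd c2 h))"
      by (rule smooth_on_differentiable)
        (use charts_atD(2)[OF c] charts_atD(2)[OF c2] charts_atD(2)[OF d] U(2) h(2) pW in force)
    moreover have o: "open (snd c ` (fst c \<inter> U))"
      by (rule open_chart_image[OF Q charts_atD(1)[OF c] U(1)])
    moreover have inj: "inj_on (snd c) (fst c)" "inj_on (snd c2) (fst c2)"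
      by (rule inj_on_chart[OF Q charts_atD(1)[OF c]] inj_on_chart[OF gmfd charts_atD(1)[OF c2]])+
    moreover from inj(1) have inj1: "inj_on (snd c) (fst c \<inter> U)"
      by (rule inj_on_subset) simp
    ultimately have "(snd d \<circ> (\<lambda>u. \<Phi> (u, h)) \<circ> chart_inv ?c1) differentiable (at (snd ?c1 ?b))"
      using charts_atD(2)[OF c] charts_atD(2)[OF c2] U(2)
      by (intro differentiable_partial_map[where ?c2.0 = c2]) simp_all
    then have "(snd d \<circ> (\<lambda>u. \<Phi> (u, h)) \<circ> chart_inv ?c1) differentiable (at (snd c ?b))"
      by (simp only: snd_conv)
    then show "(snd d \<circ> s \<circ> chart_inv c) differentiable (at (snd c ?b))"
    proof (rule differentiable_transform_open[OF _ o])
      show "snd c ?b \<in> snd c ` (fst c \<inter> U)"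
        using charts_atD(2)[OF c] U(2) by blast
      fix y assume "y \<in> snd c ` (fst c \<inter> U)"
      then obtain u where u: "u \<in> fst c \<inter> U" "y = snd c u"
        by blast
      show "(snd d \<circ> (\<lambda>u. \<Phi> (u, h)) \<circ> chart_inv ?c1) y = (snd d \<circ> s \<circ> chart_inv c) y"
        using chart_inv_snd[of ?c1 u] chart_inv_snd[of c u] inj(1) inj1 u by (simp add: s_def)
    qed
  qed
  have b: "?b \<in> points Q"
    by (rule proj_points[OF p])
  show ?thesis
  proof
    show "tangent_map Q M s ?b w \<in> tangent_space M p"
      using tangent_map_tangent[OF Q M b s] by (simp add: sb)
    \<comment> \<open>The chain rule for \<open>proj o s\<close>, which is the identity on
      \<open>U\<close>.\<close>
    have "tangent_map M Q proj (s ?b) (tangent_map Q M s ?b w) = tangent_map Q Q (\<lambda>u. u) ?b w"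
      by (rule tangent_map_compose[OF Q M b _ s _ U])
        (use p proj_differentiable h in \<open>simp_all add: fib s_def\<close>)
    then show "dproj p (tangent_map Q M s ?b w) = w"
      by (simp add: sb tangent_map_ident[OF Q b w])
  qed
qed

section \<open>Horizontal lifts of vectors and fields\<close>

lemma horizontal_diff:
  "p \<in> points M \<Longrightarrow> u \<in> horizontal p \<Longrightarrow> v \<in> horizontal p \<Longrightarrow> u - v \<in> horizontal p"
  by (simp add: horizontal_space_def tangent_space_diff[OF M] connection_diff)

lemma horizontal_tangent: "u \<in> horizontal p \<Longrightarrow> u \<in> tangent_space M p"
  by (simp add: horizontal_space_def)

text \<open>Two horizontal vectors with the same projection differ by a vector that is both
  horizontal and vertical, hence 0. So the definite description picks the horizontal part of any
  vector over the given one.\<close>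

lemma hlift_at_dproj:
  assumes p: "p \<in> points M" and v: "v \<in> tangent_space M p"
  shows "hlift_at G M Q \<phi> A p (dproj p v) = v - generator (A p v) p"
  unfolding hlift_at_def
proof (rule the_equality)
  show "v - generator (A p v) p \<in> horizontal p \<and> dproj p (v - generator (A p v) p) = dproj p v"
    using horizontal_part[OF p v] by blast
  fix u assume u: "u \<in> horizontal p \<and> dproj p u = dproj p v"
  let ?d = "u - (v - generator (A p v) p)"
  have h: "?d \<in> horizontal p"
    using horizontal_diff[OF p] u horizontal_part(1)[OF p v] by blast
  moreover have "dproj p ?d = 0"
    using u unfolding tangent_map_diff[OF M p proj_differentiable[OF p]] horizontal_part(2)[OF p v, unfolded tangent_map_diff[OF M p proj_differentiable[OF p]]]
    by simp
  ultimately have "?d \<in> vertical p"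
    by (simp add: vertical_space_def horizontal_tangent)
  from horizontal_vertical_zero[OF p h this] show "u = v - generator (A p v) p"
    by (rule right_minus_eq[THEN iffD1])
qed

lemma hlift_at:
  assumes p: "p \<in> points M" and w: "w \<in> tangent_space Q (proj p)"
  shows "hlift_at G M Q \<phi> A p w \<in> horizontal p" "dproj p (hlift_at G M Q \<phi> A p w) = w"
proof -
  obtain v where v: "v \<in> tangent_space M p" "dproj p v = w"
    using dproj_surjective[OF p w] .
  show "hlift_at G M Q \<phi> A p w \<in> horizontal p" "dproj p (hlift_at G M Q \<phi> A p w) = w"
    using hlift_at_dproj[OF p v(1)] horizontal_part[OF p v(1)] unfolding v(2) by simp_all
qed

lemma horizontal_liftD:
  assumes "horizontal_lift G M Q \<phi> A Xq X"
  shows "vector_field M X" "vector_field Q Xq"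
    "\<And>p. p \<in> points M \<Longrightarrow> X p \<in> horizontal p"
    "\<And>p. p \<in> points M \<Longrightarrow> dproj p (X p) = Xq (proj p)"
proof -
  show 1: "vector_field M X" "vector_field Q Xq"
    using assms by (simp_all add: horizontal_lift_def)
  fix p assume p: "p \<in> points M"
  have "X p = hlift_at G M Q \<phi> A p (Xq (proj p))"
    using assms p by (simp add: horizontal_lift_def)
  with hlift_at[OF p vector_field_tangent[OF 1(2) proj_points[OF p]]]
  show "X p \<in> horizontal p" "dproj p (X p) = Xq (proj p)"
    by simp_all
qed

section \<open>The Levi-Civita connection and differentiability of the metric along fields\<close>

lemma nabla_field:
  assumes "vector_field M X" "vector_field M Y"
  shows "vector_field M (nabla X Y)"
proof -
  have "\<forall>X Y. vector_field M X \<and> vector_field M Y \<longrightarrow> vector_field M (nabla X Y)"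
    using levi_civita unfolding levi_civita_def affine_connection_def by (elim conjE)
  then show ?thesis
    using assms by blast
qed

lemma nabla_torsion_free:
  assumes "vector_field M X" "vector_field M Y" "p \<in> points M"
  shows "nabla X Y p - nabla Y X p = lie_bracket M X Y p"
proof -
  have "\<forall>X Y. vector_field M X \<and> vector_field M Y \<longrightarrow>
        (\<forall>p\<in>points M. nabla X Y p - nabla Y X p = lie_bracket M X Y p)"
    using levi_civita unfolding levi_civita_def by (elim conjE)
  then show ?thesis
    using assms by blast
qed

lemma nabla_metric:
  assumes "vector_field M X" "vector_field M Y" "vector_field M Z" "p \<in> points M"
  shows "dir_deriv M (X p) (\<lambda>q. k q (Y q) (Z q)) p = k p (nabla X Y p) (Z p) + k p (Y p) (nabla X Z p)"
proof -
  have "\<forall>X Y Z. vector_field M X \<and> vector_field M Y \<and> vector_field M Z \<longrightarrow>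
        (\<forall>p\<in>points M. dir_deriv M (X p) (\<lambda>q. k q (Y q) (Z q)) p
           = k p (nabla X Y p) (Z p) + k p (Y p) (nabla X Z p))"
    using levi_civita unfolding levi_civita_def by (elim conjE)
  then show ?thesis
    using assms by blast
qed

text \<open>Vanishing torsion exhibits the bracket as a difference of two vector fields, which
  spares transforming its coordinate formula between charts.\<close>

lemma lie_bracket_tangent:
  assumes X: "vector_field M X" and Y: "vector_field M Y" and p: "p \<in> points M"
  shows "lie_bracket M X Y p \<in> tangent_space M p"
  unfolding nabla_torsion_free[OF X Y p, symmetric]
  by (intro tangent_space_diff[OF M] vector_field_tangent[OF _ p] nabla_field X Y)

text \<open>The metric is smooth by definition on coordinate vectors with constant coefficients. The
  product rule for linear families inserts \<open>Y\<close> into the second slot, and then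
  \<open>X\<close> into the first.\<close>

lemma metric_fun_differentiable:
  assumes X: "vector_field M X" and Y: "vector_field M Y" and c: "c \<in> charts_at M p"
  shows "((\<lambda>q. k q (X q) (Y q)) \<circ> chart_inv c) differentiable (at (snd c p))"
proof -
  let ?S = "snd c ` fst c" and ?p = "chart_inv c"
  let ?e = "\<lambda>y u. coord_tvec M c (?p y) u"
  have S: "open ?S" "snd c p \<in> ?S"
    using open_chart_image[OF M charts_atD(1)[OF c] openin_chart_domain[OF M charts_atD(1)[OF c]]]
      charts_atD(2)[OF c] by simp_all
  have at: "c \<in> charts_at M (?p y)" if y: "y \<in> ?S" for y
    using y charts_atD(1)[OF c] chart_inv_snd[OF inj_on_chart[OF M charts_atD(1)[OF c]]]
    by (auto simp: charts_at_def)
  have pt: "?p y \<in> points M" if "y \<in> ?S" for y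
    by (rule charts_at_points[OF M at[OF that]])
  have tan: "?e y u \<in> tangent_space M (?p y)" if "y \<in> ?S" for y u
    by (rule coord_tvec_tangent[OF M at[OF that]])
  have linL: "linear (\<lambda>u. k (?p y) (?e y u) v)" if y: "y \<in> ?S" and v: "v \<in> tangent_space M (?p y)" for y v
    by (rule linearI)
      (simp_all add: coord_tvec_add[OF M at[OF y]] coord_tvec_scale[OF M at[OF y]]
        metric_add_left[OF pt[OF y] tan[OF y] tan[OF y] v] metric_scale_left[OF pt[OF y] tan[OF y] v])
  have linR: "linear (\<lambda>v. k (?p y) (?e y u) (?e y v))" if y: "y \<in> ?S" for y u
    using linL[OF y tan[OF y], of u] metric_sym[OF pt[OF y] tan[OF y] tan[OF y], of u] by simp
  have kc: "(\<lambda>y. k (?p y) (?e y u) (?e y v)) differentiable (at (snd c p))" for u v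
  proof (rule smooth_on_differentiable[OF _ S(2)])
    have "\<forall>c\<in>atlas M. \<forall>u v. smooth_on (snd c ` fst c)
        (\<lambda>y. let p = chart_inv c y in k p (coord_tvec M c p u) (coord_tvec M c p v))"
      using metric unfolding riemannian_metric_def by (elim conjE)
    then show "smooth_on ?S (\<lambda>y. k (?p y) (?e y u) (?e y v))"
      using charts_atD(1)[OF c] unfolding Let_def by blast
  qed
  have Xc: "?e y (coord_field Z c y) = Z (?p y)" if "y \<in> ?S" "vector_field M Z" for y Z
    using tangent_space_iff[OF M at[OF that(1)]] vector_field_tangent[OF that(2) pt[OF that(1)]]
    by (simp add: coord_field_def)
  have dc: "(coord_field Z c has_derivative frechet_derivative (coord_field Z c) (at (snd c p))) (at (snd c p))"
    if "vector_field M Z" for Z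
    using coord_field_differentiable[OF that c] frechet_derivative_works by blast
  have "(\<lambda>y. k (?p y) (?e y u) (?e y (coord_field Y c y))) differentiable (at (snd c p))" for u
    by (rule differentiableI[OF has_derivative_linear_family[OF linR S kc dc[OF Y]]])
  then have "(\<lambda>y. k (?p y) (?e y u) (Y (?p y))) differentiable (at (snd c p))" for u
    by (rule differentiable_transform_open[OF _ S]) (simp add: Xc[OF _ Y])
  then have "(\<lambda>y. k (?p y) (?e y (coord_field X c y)) (Y (?p y))) differentiable (at (snd c p))"
    by (intro differentiableI[OF has_derivative_linear_family[OF linL S _ dc[OF X]]])
      (simp_all add: vector_field_tangent[OF Y] pt)
  then show ?thesis
    by (rule differentiable_transform_open[OF _ S]) (simp add: Xc[OF _ X])
qed

section \<open>Vertical parts of brackets and the curvature form\<close>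

lemma connection_coord_derivative:
  assumes X: "vector_field M X" and hX: "\<And>q. q \<in> points M \<Longrightarrow> X q \<in> horizontal q"
    and c: "c \<in> charts_at M p" and d: "d \<in> charts_at (gmfd G) \<one>\<^bsub>G\<^esub>"
  shows "A p (coord_tvec M c p (frechet_derivative (coord_field X c) (at (snd c p)) w)) d
       = - frechet_derivative (\<lambda>y. A (chart_inv c y) (coord_tvec M c (chart_inv c y) (X p c)) d) (at (snd c p)) w"
proof -
  let ?S = "snd c ` fst c" and ?p = "chart_inv c"
  let ?L = "\<lambda>y u. A (?p y) (coord_tvec M c (?p y) u) d"
  have S: "open ?S" "snd c p \<in> ?S"
    using open_chart_image[OF M charts_atD(1)[OF c] openin_chart_domain[OF M charts_atD(1)[OF c]]]
      charts_atD(2)[OF c] by simp_all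
  have at: "c \<in> charts_at M (?p y)" if y: "y \<in> ?S" for y
    using y charts_atD(1)[OF c] chart_inv_snd[OF inj_on_chart[OF M charts_atD(1)[OF c]]]
    by (auto simp: charts_at_def)
  have pt: "?p y \<in> points M" if "y \<in> ?S" for y
    by (rule charts_at_points[OF M at[OF that]])
  have tan: "coord_tvec M c (?p y) u \<in> tangent_space M (?p y)" if "y \<in> ?S" for y u
    by (rule coord_tvec_tangent[OF M at[OF that]])
  have lin: "linear (?L y)" if y: "y \<in> ?S" for y
  proof (rule linearI)
    show "?L y (u + v) = ?L y u + ?L y v" for u v
      by (simp add: coord_tvec_add[OF M at[OF y]] connection_add[OF pt[OF y] tan[OF y] tan[OF y]])
    show "?L y (r *\<^sub>R u) = r *\<^sub>R ?L y u" for r u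
      unfolding coord_tvec_scale[OF M at[OF y]] connection_scale[OF pt[OF y] tan[OF y]] by (simp add: tscale_def)
  qed
  have diff: "(\<lambda>y. ?L y u) differentiable (at (snd c p))" for u
  proof (rule smooth_on_differentiable[OF _ S(2)])
    have "\<forall>c\<in>atlas M. \<forall>d\<in>charts_at (gmfd G) \<one>\<^bsub>G\<^esub>. \<forall>u. smooth_on (snd c ` fst c)
        (\<lambda>y. let p = chart_inv c y in A p (coord_tvec M c p u) d)"
      using connection unfolding principal_connection_def by (elim conjE)
    then show "smooth_on ?S (\<lambda>y. ?L y u)"
      using charts_atD(1)[OF c] d unfolding Let_def by blast
  qed
  have dX: "(coord_field X c has_derivative frechet_derivative (coord_field X c) (at (snd c p))) (at (snd c p))"
    using coord_field_differentiable[OF X c] frechet_derivative_works by blast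
  have zero: "?L y (coord_field X c y) = 0" if y: "y \<in> ?S" for y
  proof -
    have "coord_tvec M c (?p y) (coord_field X c y) = X (?p y)"
      using tangent_space_iff[OF M at[OF y]] vector_field_tangent[OF X pt[OF y]] by (simp add: coord_field_def)
    then show ?thesis
      using hX[OF pt[OF y]] by (simp add: horizontal_space_def)
  qed
  have "((\<lambda>y. 0) has_derivative (\<lambda>w. ?L (snd c p) (frechet_derivative (coord_field X c) (at (snd c p)) w)
      + frechet_derivative (\<lambda>y. ?L y (coord_field X c (snd c p))) (at (snd c p)) w)) (at (snd c p))"
    by (rule has_derivative_transform_within_open[OF _ S zero]) (rule has_derivative_linear_family[OF lin S diff dX])
  from fun_cong[OF has_derivative_unique[OF this has_derivative_const]]
  show ?thesis
    by (simp add: coord_field_at[OF M c] chart_inv_chart_at[OF M c] eq_neg_iff_add_eq_0)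
qed

text \<open>Up to sign, both sides are the differential of \<open>A\<close> evaluated on the two fields, because the
  derivatives of the fields drop out.\<close>

lemma connection_bracket_cong:
  assumes X: "vector_field M X" "vector_field M X'" "\<And>q. q \<in> points M \<Longrightarrow> X q \<in> horizontal q"
      "\<And>q. q \<in> points M \<Longrightarrow> X' q \<in> horizontal q" "X p = X' p"
    and Y: "vector_field M Y" "vector_field M Y'" "\<And>q. q \<in> points M \<Longrightarrow> Y q \<in> horizontal q"
      "\<And>q. q \<in> points M \<Longrightarrow> Y' q \<in> horizontal q" "Y p = Y' p"
    and p: "p \<in> points M"
  shows "A p (lie_bracket M X Y p) = A p (lie_bracket M X' Y' p)"
proof
  fix d
  obtain c where c: "c \<in> charts_at M p"
    using charts_at_nonempty[OF M p] by blast
  let ?D = "\<lambda>Z w. coord_tvec M c p (frechet_derivative (coord_field Z c) (at (snd c p)) w)"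
  \<comment> \<open>The bracket is rebuilt from its coordinates in the single chart
    \<open>c\<close>, as a difference of two vectors to which \<open>A\<close> can be applied
    separately.\<close>
  have br: "lie_bracket M Z W p = ?D W (Z p c) - ?D Z (W p c)"
    if "vector_field M Z" "vector_field M W" for Z W
  proof -
    let ?a = "frechet_derivative (coord_field W c) (at (snd c p)) (Z p c)"
    let ?b = "frechet_derivative (coord_field Z c) (at (snd c p)) (W p c)"
    have "lie_bracket M Z W p = coord_tvec M c p (lie_bracket M Z W p c)"
      using tangent_space_iff[OF M c] lie_bracket_tangent[OF that p] by blast
    also have "lie_bracket M Z W p c = ?a + (-1) *\<^sub>R ?b"
      using c by (simp add: lie_bracket_def)
    finally show ?thesis
      by (simp only: coord_tvec_add[OF M c] coord_tvec_scale[OF M c] diff_tvec)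
  qed
  show "A p (lie_bracket M X Y p) d = A p (lie_bracket M X' Y' p) d"
  proof (cases "d \<in> charts_at (gmfd G) \<one>\<^bsub>G\<^esub>")
    case d: True
    show ?thesis
      unfolding br[OF X(1) Y(1)] br[OF X(2) Y(2)]
        connection_diff[OF p coord_tvec_tangent[OF M c] coord_tvec_tangent[OF M c]]
      by (simp add: X(5) Y(5)
          connection_coord_derivative[OF X(1,3) c d] connection_coord_derivative[OF X(2,4) c d]
          connection_coord_derivative[OF Y(1,3) c d] connection_coord_derivative[OF Y(2,4) c d])
  next
    case False
    have "A p (lie_bracket M Z W p) d = 0" if "vector_field M Z" "vector_field M W" for Z W
      using connection_in_lie_algebra[OF p lie_bracket_tangent[OF that p]] False
      unfolding lie_algebra_def by (rule tangent_space_outside)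
    then show ?thesis
      using X(1,2) Y(1,2) by simp
  qed
qed

text \<open>The lifts are related by the projection to the base fields, hence so are the brackets;
  lifting the projected bracket returns its horizontal part.\<close>

lemma lie_bracket_horizontal_lift:
  assumes X: "horizontal_lift G M Q \<phi> A Xq X" and Y: "horizontal_lift G M Q \<phi> A Yq Y"
    and p: "p \<in> points M"
  shows "hlift_at G M Q \<phi> A p (lie_bracket Q Xq Yq (proj p))
       = lie_bracket M X Y p - generator (A p (lie_bracket M X Y p)) p"
proof -
  note X = horizontal_liftD[OF X] and Y = horizontal_liftD[OF Y]
  have "dproj p (lie_bracket M X Y p) = lie_bracket Q Xq Yq (proj p)"
    by (rule lie_bracket_related[OF M Q proj_smooth X(1) Y(1) X(2) Y(2) X(4) Y(4) p])
  then show ?thesis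
    using hlift_at_dproj[OF p lie_bracket_tangent[OF X(1) Y(1) p]] by simp
qed

text \<open>For lifts \<open>Z\<close>, \<open>W\<close> the defining identity says that the
  generator of \<open>\<beta>\<close> is minus that of \<open>A[Z, W]\<close>, whence the sign. The
  same \<open>\<beta>\<close> works for all lifts with the prescribed values by
  \<open>connection_bracket_cong\<close>. It is unique because \<open>X\<close> and \<open>Y\<close>
  are themselves such lifts and \<open>A\<close> recovers an element of the Lie algebra from its
  generator.\<close>

lemma curvature_form_eq:
  assumes X: "horizontal_lift G M Q \<phi> A Xq X" and Y: "horizontal_lift G M Q \<phi> A Yq Y"
    and p: "p \<in> points M"
  shows "curvature_form G M Q \<phi> A p (X p) (Y p) = tscale (-1) (A p (lie_bracket M X Y p))"
proof -
  note X' = horizontal_liftD[OF X] and Y' = horizontal_liftD[OF Y]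
  note tan = lie_bracket_tangent[OF X'(1) Y'(1) p]
  let ?\<beta> = "tscale (-1) (A p (lie_bracket M X Y p))"
  have \<beta>: "?\<beta> \<in> lie_algebra G"
    using connection_in_lie_algebra[OF p tangent_space_scale[OF M tan, of "-1"]] connection_scale[OF p tan]
    by simp
  have gen: "generator ?\<beta> p = - generator (A p (lie_bracket M X Y p)) p"
    unfolding generator_scale[OF p] by (simp add: tscale_def fun_eq_iff)
  \<comment> \<open>The curvature form first passes to the horizontal parts of its arguments;
    horizontal vectors are their own.\<close>
  have val: "u - generator (A p u) p = u" if "u \<in> horizontal p" for u
    using that generator_zero[OF p] by (simp add: horizontal_space_def)
  show ?thesis
    unfolding curvature_form_def val[OF X'(3)[OF p]] val[OF Y'(3)[OF p]]
  proof (rule the_equality, intro conjI allI impI \<beta>)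
    fix Xq' Yq' Z W
    assume *: "horizontal_lift G M Q \<phi> A Xq' Z \<and> horizontal_lift G M Q \<phi> A Yq' W \<and> Z p = X p \<and> W p = Y p"
    then have Z: "horizontal_lift G M Q \<phi> A Xq' Z" and W: "horizontal_lift G M Q \<phi> A Yq' W"
      and eq: "X p = Z p" "Y p = W p"
      by simp_all
    note Z' = horizontal_liftD[OF Z] and W' = horizontal_liftD[OF W]
    have "A p (lie_bracket M X Y p) = A p (lie_bracket M Z W p)"
      by (rule connection_bracket_cong[OF X'(1) Z'(1) X'(3) Z'(3) eq(1) Y'(1) W'(1) Y'(3) W'(3) eq(2) p])
    then show "lie_bracket M Z W p
        = hlift_at G M Q \<phi> A p (lie_bracket Q Xq' Yq' (proj p)) - generator ?\<beta> p"
      unfolding lie_bracket_horizontal_lift[OF Z W p] gen by simp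
  next
    fix \<beta>
    assume \<beta>': "\<beta> \<in> lie_algebra G \<and> (\<forall>Xq' Yq' Z W. horizontal_lift G M Q \<phi> A Xq' Z \<and>
        horizontal_lift G M Q \<phi> A Yq' W \<and> Z p = X p \<and> W p = Y p \<longrightarrow>
        lie_bracket M Z W p = hlift_at G M Q \<phi> A p (lie_bracket Q Xq' Yq' (proj p)) - generator \<beta> p)"
    then have "lie_bracket M X Y p = hlift_at G M Q \<phi> A p (lie_bracket Q Xq Yq (proj p)) - generator \<beta> p"
      using X Y by blast
    then have "generator \<beta> p = generator ?\<beta> p"
      unfolding lie_bracket_horizontal_lift[OF X Y p] gen by (simp add: algebra_simps eq_neg_iff_add_eq_0)
    then show "\<beta> = ?\<beta>"
      using connection_generator[OF p] \<beta> \<beta>' by metis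
  qed
qed

section \<open>Koszul computation with horizontal and vertical fields\<close>

lemma lie_bracket_vertical:
  assumes X: "horizontal_lift G M Q \<phi> A Xq X" and V: "vector_field M V" "\<And>q. q \<in> points M \<Longrightarrow> V q \<in> vertical q"
    and p: "p \<in> points M"
  shows "lie_bracket M X V p \<in> vertical p"
proof -
  note X = horizontal_liftD[OF X]
  \<comment> \<open>\<open>V\<close> is related to the zero field, so the bracket projects to
    \<open>[Xq, 0]\<close>.\<close>
  have "dproj p (lie_bracket M X V p) = lie_bracket Q Xq (\<lambda>q. 0) (proj p)"
    using V(2) by (intro lie_bracket_related[OF M Q proj_smooth X(1) V(1) X(2) vector_field_zero[OF Q] X(4) _ p])
      (simp_all add: vertical_space_def)
  then show ?thesis
    using lie_bracket_zero_right[OF Q X(2)] lie_bracket_tangent[OF X(1) V(1) p]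
    by (simp add: vertical_space_def)
qed

text \<open>The generator is the image of \<open>\<xi>\<close> under the tangent map of
  \<open>g |-> \<phi> g p\<close>. Pulled back along this map the function is constant, since the
  metric and both fields are invariant.\<close>

lemma dir_deriv_invariant:
  assumes inv: "invariant_metric G M \<phi> k" and X: "vector_field M X" "invariant_field G M \<phi> X"
    and Y: "vector_field M Y" "invariant_field G M \<phi> Y" and p: "p \<in> points M"
  shows "dir_deriv M (generator \<xi> p) (\<lambda>q. k q (X q) (Y q)) p = 0"
proof -
  let ?f = "\<lambda>q. k q (X q) (Y q)"
  have one: "\<one>\<^bsub>G\<^esub> \<in> points (gmfd G)"
    using one_closed gpoints by simp
  have const: "k p (X p) (Y p) = ?f (\<phi> g p)" if "g \<in> points (gmfd G)" for g
  proof -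
    have g: "g \<in> carrier G"
      using that gpoints by simp
    have "X (\<phi> g p) = tangent_map M M (\<phi> g) p (X p)" "Y (\<phi> g p) = tangent_map M M (\<phi> g) p (Y p)"
      using X(2) Y(2) g p unfolding invariant_field_def by blast+
    moreover have "k (\<phi> g p) (tangent_map M M (\<phi> g) p (X p)) (tangent_map M M (\<phi> g) p (Y p)) = k p (X p) (Y p)"
      using inv g p vector_field_tangent[OF X(1) p] vector_field_tangent[OF Y(1) p]
      unfolding invariant_metric_def by blast
    ultimately show ?thesis
      by simp
  qed
  have "dir_deriv M (generator \<xi> p) ?f (\<phi> \<one>\<^bsub>G\<^esub> p) = dir_deriv (gmfd G) \<xi> (\<lambda>g. k p (X p) (Y p)) \<one>\<^bsub>G\<^esub>"
    unfolding inf_generator_def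
    by (rule dir_deriv_tangent_map[where f = "\<lambda>g. \<phi> g p" and g = ?f,
          OF gmfd M one _ orbit_map_differentiable[OF p] _ openin_topspace one const])
      (use p metric_fun_differentiable[OF X(1) Y(1)] in \<open>simp_all add: action_one\<close>)
  also have "\<dots> = 0"
    by (rule dir_deriv_zero[OF gmfd one openin_topspace one refl])
  finally show ?thesis
    using p by (simp add: action_one)
qed

text \<open>Metric compatibility turns the constancy of \<open>k(X, V)\<close>, \<open>k(Y, V)\<close> and of \<open>k(X, Y)\<close> along \<open>V\<close> into linear relations, and torsion
  enters only through \<open>[X, Y]\<close>, as \<open>[X, V]\<close> and \<open>[Y, V]\<close> are vertical.\<close>

lemma symmetric_product_horizontal_vertical:
  assumes inv: "invariant_metric G M \<phi> k"
    and hX: "horizontal_lift G M Q \<phi> A Xq X" and iX: "invariant_field G M \<phi> X"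
    and hY: "horizontal_lift G M Q \<phi> A Yq Y" and iY: "invariant_field G M \<phi> Y"
    and V: "vector_field M V" "\<And>q. q \<in> points M \<Longrightarrow> V q \<in> vertical q"
    and p: "p \<in> points M" and Vp: "V p = generator \<xi> p"
  shows "k p (symmetric_product nabla X V p) (Y p) = - k p (lie_bracket M X Y p) (V p)"
proof -
  note X = horizontal_liftD[OF hX] and Y = horizontal_liftD[OF hY]
  have n: "nabla Z W p \<in> tangent_space M p" if "vector_field M Z" "vector_field M W" for Z W
    by (rule vector_field_tangent[OF nabla_field[OF that] p])
  note t = vector_field_tangent[OF _ p]
  have compat: "dir_deriv M (Z p) (\<lambda>q. k q (U q) (W q)) p = k p (nabla Z U p) (W p) + k p (nabla Z W p) (U p)"
    if "vector_field M Z" "vector_field M U" "vector_field M W" for Z U W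
  proof -
    have "dir_deriv M (Z p) (\<lambda>q. k q (U q) (W q)) p = k p (nabla Z U p) (W p) + k p (U p) (nabla Z W p)"
      by (rule nabla_metric[OF that p])
    then show ?thesis
      using metric_sym[OF p t[OF that(2)] n[OF that(1,3)]] by simp
  qed
  \<comment> \<open>Orthogonality holds at every point, so the function being differentiated is
    identically 0.\<close>
  have zero: "dir_deriv M (Z p) (\<lambda>q. k q (U q) (V q)) p = 0" if "horizontal_lift G M Q \<phi> A Uq U" for Z U Uq
    by (rule dir_deriv_zero[OF M p openin_topspace p])
      (rule metric_horizontal_vertical[OF _ horizontal_liftD(3)[OF that] V(2)])
  have bracket: "k p (nabla Z V p) (U p) = k p (nabla V Z p) (U p)"
    if Z: "horizontal_lift G M Q \<phi> A Zq Z" and U: "horizontal_lift G M Q \<phi> A Uq U" for Z U Zq Uq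
  proof -
    note Z' = horizontal_liftD[OF Z] and U' = horizontal_liftD[OF U]
    have "k p (U p) (lie_bracket M Z V p) = 0"
      by (rule metric_horizontal_vertical[OF p U'(3)[OF p] lie_bracket_vertical[OF Z V p]])
    then have "k p (lie_bracket M Z V p) (U p) = 0"
      using metric_sym[OF p t[OF U'(1)] lie_bracket_tangent[OF Z'(1) V(1) p]] by simp
    then show ?thesis
      unfolding nabla_torsion_free[OF Z'(1) V(1) p, symmetric]
      by (simp add: metric_diff_left[OF p n[OF Z'(1) V(1)] n[OF V(1) Z'(1)] t[OF U'(1)]])
  qed
  \<comment> \<open>With \<open>a = k(nabla_X V, Y)\<close> and \<open>b = k(nabla_Y V, X)\<close>,
    the first two relations make \<open>-a\<close> and \<open>-b\<close> the vertical components of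
    \<open>nabla_X Y\<close> and \<open>nabla_Y X\<close> against \<open>V\<close>. By
    \<open>bracket\<close> the third relation reads \<open>a + b = 0\<close>. Thus
    \<open>k([X, Y], V) = b - a = -2 a\<close>, while the symmetric product paired with
    \<open>Y\<close> is \<open>2 a\<close>.\<close>
  have "k p (nabla X Y p) (V p) + k p (nabla X V p) (Y p) = 0"
    using compat[OF X(1) Y(1) V(1)] zero[OF hY] by simp
  moreover have "k p (nabla Y X p) (V p) + k p (nabla Y V p) (X p) = 0"
    using compat[OF Y(1) X(1) V(1)] zero[OF hX] by simp
  moreover have "k p (nabla V X p) (Y p) + k p (nabla V Y p) (X p) = 0"
    using compat[OF V(1) X(1) Y(1)] dir_deriv_invariant[OF inv X(1) iX Y(1) iY p] by (simp add: Vp)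
  moreover have "k p (lie_bracket M X Y p) (V p) = k p (nabla X Y p) (V p) - k p (nabla Y X p) (V p)"
    unfolding nabla_torsion_free[OF X(1) Y(1) p, symmetric] by (rule metric_diff_left[OF p n[OF X(1) Y(1)] n[OF Y(1) X(1)] t[OF V(1)]])
  ultimately show ?thesis
    unfolding symmetric_product_def metric_add_left[OF p n[OF X(1) V(1)] n[OF V(1) X(1)] t[OF Y(1)]]
    using bracket[OF hX hY] bracket[OF hY hX] by linarith
qed

text \<open>The generator of the curvature is minus the generator of \<open>A[X, Y]\<close>, and the
  latter differs from \<open>[X, Y]\<close> by a horizontal vector, which a vertical
  \<open>v\<close> does not see.\<close>

lemma metric_generator_curvature:
  assumes hX: "horizontal_lift G M Q \<phi> A Xq X" and hY: "horizontal_lift G M Q \<phi> A Yq Y"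
    and p: "p \<in> points M" and v: "v \<in> vertical p"
  shows "k p (generator (curvature_form G M Q \<phi> A p (X p) (Y p)) p) v = - k p (lie_bracket M X Y p) v"
proof -
  note X = horizontal_liftD[OF hX] and Y = horizontal_liftD[OF hY]
  let ?l = "lie_bracket M X Y p"
  have l: "?l \<in> tangent_space M p"
    by (rule lie_bracket_tangent[OF X(1) Y(1) p])
  have v': "v \<in> tangent_space M p"
    using v by (simp add: vertical_space_def)
  have "k p (?l - generator (A p ?l) p) v = 0"
    by (rule metric_horizontal_vertical[OF p horizontal_part(1)[OF p l] v])
  then show ?thesis
    unfolding curvature_form_eq[OF hX hY p] generator_scale[OF p]
    by (simp add: metric_diff_left[OF p l generator_tangent[OF p] v'] metric_scale_left[OF p generator_tangent[OF p] v'])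
qed

end

theorem lemma5p1:
  fixes M :: "('m, 'e::fin_dim_inner) manifold"
    and G :: "('g, 'f::fin_dim_inner) lie_grp"
    and Q :: "('m set, 'b::fin_dim_inner) manifold"
    and \<phi> :: "'g \<Rightarrow> 'm \<Rightarrow> 'm"
    and k :: "'m \<Rightarrow> ('m, 'e) tvec \<Rightarrow> ('m, 'e) tvec \<Rightarrow> real"
    and nabla :: "('m \<Rightarrow> ('m, 'e) tvec) \<Rightarrow> ('m \<Rightarrow> ('m, 'e) tvec) \<Rightarrow> 'm \<Rightarrow> ('m, 'e) tvec"
    and A :: "'m \<Rightarrow> ('m, 'e) tvec \<Rightarrow> ('g, 'f) tvec"
    and Xq Yq :: "'m set \<Rightarrow> ('m set, 'b) tvec"
    and Xh Yh V :: "'m \<Rightarrow> ('m, 'e) tvec"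
    and x :: 'm and \<xi> :: "('g, 'f) tvec"
  assumes "smooth_manifold M" and "riemannian_metric M k"
    and "lie_group G" and "smooth_action G M \<phi>"
    and "free_action G M \<phi>" and "proper_action G M \<phi>"
    and "principal_bundle G M Q \<phi>"
    and "invariant_metric G M \<phi> k"
    and "mechanical_connection G M Q \<phi> k A"
    and "levi_civita M k nabla"
    and "horizontal_lift G M Q \<phi> A Xq Xh" and "invariant_field G M \<phi> Xh"
    and "horizontal_lift G M Q \<phi> A Yq Yh" and "invariant_field G M \<phi> Yh"
    and "x \<in> points M" and "\<xi> \<in> lie_algebra G"
    and "vector_field M V" and "invariant_field G M \<phi> V"
    and "\<forall>y\<in>points M. V y \<in> vertical_space G M Q \<phi> y"
    and "V x = inf_generator G M \<phi> \<xi> x"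
  shows "k x (symmetric_product nabla Xh V x) (Yh x)
       = k x (inf_generator G M \<phi> (curvature_form G M Q \<phi> A x (Xh x) (Yh x)) x) (V x)"
proof -
  interpret mechanical_bundle M G Q \<phi> k nabla A
    by (rule mechanical_bundle.intro) fact+
  have V: "V y \<in> vertical y" if "y \<in> points M" for y
    using assms(19) that by blast
  have "k x (symmetric_product nabla Xh V x) (Yh x) = - k x (lie_bracket M Xh Yh x) (V x)"
    by (rule symmetric_product_horizontal_vertical) (fact | rule V, assumption)+
  also have "\<dots> = k x (generator (curvature_form G M Q \<phi> A x (Xh x) (Yh x)) x) (V x)"
    by (rule metric_generator_curvature[symmetric]) (fact | rule V)+
  finally show ?thesis .
qed

end
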